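(* Let $I$ be a non-empty singular support of full resonance rank. Suppose that the quotient germ $q_I:(\mathbb C^J,0)\to(Q_I,o_I)$ is given with the labels of the residual coordinates $w_j$, $j\in J$, and that the logarithmic connection $\nabla_I$ is given with the labels of the support coordinates $z_i$, $i\in I$. Then the labelled quotient and the labelled logarithmic connection determine the ambient weight configuration $(\Lambda_1,\dots,\Lambda_n)$ up to linear equivalence. More explicitly, set $R_I=M_I\otimes_{\mathbb Z}\mathbb C\subset\mathbb C^J$, $W_I=\mathbb C^J/R_I$ and let $\pi_I^{\mathrm{res}}:\mathbb C^J\to W_I$ be the quotient map. Choose any linear extension $A:\mathbb C^J\to\mathbb C^I$ of $C_I^{\mathbb C}:R_I\to\mathbb C^I$. On $\mathbb C^I\oplus W_I$ define $$\widehat\Lambda_i=(e_i,0)\ (i\in I),\qquad \widehat\Lambda_j=\bigl(A(e_j),\pi_I^{\mathrm{res}}(e_j)\bigr)\ (j\in J).$$ The linear-equivalence class of $(\widehat\Lambda_1,\dots,\widehat\Lambda_n)$ is independent of the extension $A$ and is the linear-equivalence class of the original weights $(\Lambda_1,\dots,\Lambda_n)$.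
   Context: Let $\mathfrak g=\mathbb C^k$ and let $\Lambda_1,\dots,\Lambda_n\in\mathfrak g^*$ span $\mathfrak g^*$ (weights of the diagonal action $t\cdot z=(e^{\Lambda_j(t)}z_j)_j$). For $I\subset\{1,\dots,n\}$ put $J=I^c$, $r_I=\dim\operatorname{Span}\{\Lambda_i:i\in I\}$, $\mathfrak h_I=\bigcap_{i\in I}\ker\Lambda_i$; $I$ is a singular support if $r_I<k$. $S_I=\{\alpha\in\mathbb N^J:\sum_{j\in J}\alpha_j\Lambda_j|_{\mathfrak h_I}=0\}$ ($0\in\mathbb N$), $M_I=\operatorname{gp}(S_I)$, $Q_I=\operatorname{Spec}\mathbb C[S_I]$, $q_I^*X^\alpha=w^\alpha$, $o_I=q_I(0)$. Full resonance rank means $\dim Q_I=n-k$; it forces the support weights $\Lambda_i$, $i\in I$, to be linearly independent. For $\alpha\in M_I$, the covector $\sum_{j\in J}\alpha_j\Lambda_j$ vanishes on $\mathfrak h_I$ and is uniquely $\sum_{i\in I}c_i(\alpha)\Lambda_i$. $C_I:M_I\to\mathbb C^I$ is $C_I(\alpha)=(c_i(\alpha))_{i\in I}$, and $C_I^{\mathbb C}:R_I\to\mathbb C^I$ is its complex-linear extension. The logarithmic connection on $\mathcal O_{(\mathbb C^* )^I}\otimes\mathbb C[S_I]$ is $\nabla_I=d-\sum_{i\in I}\frac{dz_i}{z_i}\delta_i$, $\delta_iX^\alpha=c_i(\alpha)X^\alpha$. Two labelled configurations of vectors are linearly equivalent if a linear isomorphism of the ambient vector spaces carries each labelled vector to the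 one with the same label. *)

theory Defs
  imports
    "HOL-Analysis.Analysis"
    "HOL-Algebra.Module"
    "HOL-Algebra.QuotRing"
    "HOL-Library.Poly_Mapping"
    "HOL-Library.Extended_Nat"
begin

text \<open>
  Conventions.  The index set \<open>{1,...,n}\<close> is the finite type \<open>'n\<close>, so \<open>n = CARD('n)\<close>, and
  \<open>J\<close> is the complement \<open>- I\<close>.  The space \<open>\<gg> = \<complex>^k\<close> is \<open>complex ^ 'k\<close>; a covector is given by its
  coordinates in the dual basis, so the dual space is again \<open>complex ^ 'k\<close>, paired by \<open>pairing\<close>.
  For \<open>K\<close> a set of indices, \<open>\<complex>^K\<close> is the coordinate subspace of \<open>complex ^ 'n\<close> of the vectors
  supported in \<open>K\<close>, and \<open>\<nat>^K\<close>, \<open>\<int>^K\<close> are treated in the same way.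
\<close>

section \<open>Complex vector spaces with carriers, and labelled configurations\<close>

text \<open>
  Vector spaces are records of the type of HOL-Algebra modules, with scalars \<open>complex\<close>.  The
  ring fields \<open>mult\<close> and \<open>one\<close> of such a record have no meaning for a module.
\<close>

definition complex_ring :: "complex ring" where
  "complex_ring = \<lparr>carrier = UNIV, mult = (*), one = 1, zero = 0, add = (+)\<rparr>"

definition coord_space :: "'n set \<Rightarrow> (complex, complex ^ 'n) module" where
  "coord_space K =
     \<lparr>carrier = {v. \<forall>i. i \<notin> K \<longrightarrow> v $ i = 0}, mult = undefined, one = undefined,
      zero = 0, add = (+), smult = (*s)\<rparr>"

definition quotient_space :: "(complex, 'v) module \<Rightarrow> 'v set \<Rightarrow> (complex, 'v set) module" where
  "quotient_space V R =
     \<lparr>carrier = a_rcosets\<^bsub>V\<^esub> R, mult = undefined, one = undefined,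
      zero = R, add = set_add V,
      smult = (\<lambda>c W. \<Union>x\<in>W. R +>\<^bsub>V\<^esub> (c \<odot>\<^bsub>V\<^esub> x))\<rparr>"

definition direct_sum ::
  "(complex, 'v) module \<Rightarrow> (complex, 'w) module \<Rightarrow> (complex, 'v \<times> 'w) module" where
  "direct_sum V W =
     \<lparr>carrier = carrier V \<times> carrier W, mult = undefined, one = undefined,
      zero = (\<zero>\<^bsub>V\<^esub>, \<zero>\<^bsub>W\<^esub>),
      add = (\<lambda>(v, w) (v', w'). (v \<oplus>\<^bsub>V\<^esub> v', w \<oplus>\<^bsub>W\<^esub> w')),
      smult = (\<lambda>c (v, w). (c \<odot>\<^bsub>V\<^esub> v, c \<odot>\<^bsub>W\<^esub> w))\<rparr>"

definition linearly_equivalent ::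
  "(complex, 'v) module \<Rightarrow> ('i \<Rightarrow> 'v) \<Rightarrow> (complex, 'w) module \<Rightarrow> ('i \<Rightarrow> 'w) \<Rightarrow> bool" where
  "linearly_equivalent V v W w \<longleftrightarrow>
     (\<exists>T. bij_betw T (carrier V) (carrier W) \<and>
          (\<forall>x\<in>carrier V. \<forall>y\<in>carrier V. T (x \<oplus>\<^bsub>V\<^esub> y) = T x \<oplus>\<^bsub>W\<^esub> T y) \<and>
          (\<forall>c. \<forall>x\<in>carrier V. T (c \<odot>\<^bsub>V\<^esub> x) = c \<odot>\<^bsub>W\<^esub> T x) \<and>
          (\<forall>i. T (v i) = w i))"

definition clinear_on :: "(complex ^ 'n) set \<Rightarrow> (complex ^ 'n \<Rightarrow> complex ^ 'm) \<Rightarrow> bool" where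
  "clinear_on V f \<longleftrightarrow>
     (\<forall>x\<in>V. \<forall>y\<in>V. f (x + y) = f x + f y) \<and> (\<forall>c. \<forall>x\<in>V. f (c *s x) = c *s f x)"


section \<open>Weights, resonances and full resonance rank\<close>

definition pairing :: "complex ^ 'k \<Rightarrow> complex ^ 'k \<Rightarrow> complex" where
  "pairing l t = (\<Sum>a\<in>UNIV. l $ a * t $ a)"

definition support_rank :: "('n \<Rightarrow> complex ^ 'k) \<Rightarrow> 'n set \<Rightarrow> nat" where
  "support_rank \<Lambda> I = vec.dim (\<Lambda> ` I)"

definition singular_support :: "('n \<Rightarrow> complex ^ 'k) \<Rightarrow> 'n set \<Rightarrow> bool" where
  "singular_support \<Lambda> I \<longleftrightarrow> support_rank \<Lambda> I < CARD('k)"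

definition isotropy :: "('n \<Rightarrow> complex ^ 'k) \<Rightarrow> 'n set \<Rightarrow> (complex ^ 'k) set" where
  "isotropy \<Lambda> I = {t. \<forall>i\<in>I. pairing (\<Lambda> i) t = 0}"

definition resonances :: "('n::finite \<Rightarrow> complex ^ 'k) \<Rightarrow> 'n set \<Rightarrow> (nat ^ 'n) set" where
  "resonances \<Lambda> I =
     {\<alpha>. (\<forall>i\<in>I. \<alpha> $ i = 0) \<and>
         (\<forall>t\<in>isotropy \<Lambda> I. (\<Sum>j\<in>-I. of_nat (\<alpha> $ j) * pairing (\<Lambda> j) t) = 0)}"

definition nat_vec_to_int :: "nat ^ 'n \<Rightarrow> int ^ 'n" where
  "nat_vec_to_int \<alpha> = (\<chi> j. int (\<alpha> $ j))"

definition int_vec_to_complex :: "int ^ 'n \<Rightarrow> complex ^ 'n" where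
  "int_vec_to_complex \<alpha> = (\<chi> j. of_int (\<alpha> $ j))"

definition resonance_group :: "('n::finite \<Rightarrow> complex ^ 'k) \<Rightarrow> 'n set \<Rightarrow> (int ^ 'n) set" where
  "resonance_group \<Lambda> I =
     {nat_vec_to_int \<alpha> - nat_vec_to_int \<beta> | \<alpha> \<beta>. \<alpha> \<in> resonances \<Lambda> I \<and> \<beta> \<in> resonances \<Lambda> I}"

text \<open>\<open>R\<^sub>I\<close>: since \<open>M\<^sub>I\<close> lies in \<open>\<int>^J\<close>, the map from \<open>M\<^sub>I \<otimes> \<complex>\<close> to \<open>\<complex>^J\<close> is injective and its
  image is the complex span of \<open>M\<^sub>I\<close>.\<close>

definition resonance_space ::
  "('n::finite \<Rightarrow> complex ^ 'k) \<Rightarrow> 'n set \<Rightarrow> (complex ^ 'n) set" where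
  "resonance_space \<Lambda> I = vec.span (int_vec_to_complex ` resonance_group \<Lambda> I)"

text \<open>The monoid algebra \<open>\<complex>[S]\<close>, with \<open>X^\<alpha>\<close> represented by \<open>Poly_Mapping.single \<alpha> 1\<close>.\<close>

definition monoid_algebra :: "(nat ^ 'n::finite) set \<Rightarrow> ((nat ^ 'n) \<Rightarrow>\<^sub>0 complex) ring" where
  "monoid_algebra S =
     \<lparr>carrier = {p. Poly_Mapping.keys p \<subseteq> S}, mult = (*), one = 1, zero = 0, add = (+)\<rparr>"

abbreviation resonance_algebra ::
  "('n::finite \<Rightarrow> complex ^ 'k) \<Rightarrow> 'n set \<Rightarrow> ((nat ^ 'n) \<Rightarrow>\<^sub>0 complex) ring" where
  "resonance_algebra \<Lambda> I \<equiv> monoid_algebra (resonances \<Lambda> I)"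

definition krull_dim :: "('a, 'b) ring_scheme \<Rightarrow> enat" where
  "krull_dim R =
     Sup {enat m | m. \<exists>P :: nat \<Rightarrow> 'a set.
            (\<forall>i\<le>m. primeideal (P i) R) \<and> (\<forall>i<m. P i \<subset> P (Suc i))}"

text \<open>\<open>dim Q\<^sub>I = n - k\<close>, written additively.\<close>

definition full_resonance_rank :: "('n::finite \<Rightarrow> complex ^ 'k) \<Rightarrow> 'n set \<Rightarrow> bool" where
  "full_resonance_rank \<Lambda> I \<longleftrightarrow>
     krull_dim (resonance_algebra \<Lambda> I) + enat CARD('k) = enat CARD('n)"


section \<open>The quotient germ\<close>

text \<open>
  \<open>F\<close> is a germ at the origin of a holomorphic function of the variables indexed by the finite
  set \<open>A\<close>: it is the sum of a power series converging on a polydisc.  Summation by \<open>has_sum\<close> is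
  unconditional, hence absolute.
\<close>

definition analytic_at_origin :: "'a set \<Rightarrow> (('a \<Rightarrow> complex) \<Rightarrow> complex) \<Rightarrow> bool" where
  "analytic_at_origin A F \<longleftrightarrow>
     (\<exists>a. \<exists>r>0. \<forall>y. (\<forall>i\<in>A. norm (y i) < r) \<longrightarrow>
        ((\<lambda>\<nu>. a \<nu> * (\<Prod>i\<in>A. y i ^ \<nu> i)) has_sum F y) {\<nu> :: 'a \<Rightarrow> nat. \<forall>i. i \<notin> A \<longrightarrow> \<nu> i = 0})"

text \<open>
  The closed points of \<open>Spec R\<close>, for \<open>R = \<complex>[S]\<close>, are the homomorphisms of \<open>\<complex>\<close>-algebras \<open>R \<rightarrow> \<complex>\<close>;
  \<open>x p\<close> is the value at the point \<open>x\<close> of the regular function \<open>p\<close>.  The analytic topology is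
  that of pointwise convergence, which is the topology of the function type.
\<close>

definition spec_points ::
  "((nat ^ 'n::finite) \<Rightarrow>\<^sub>0 complex) ring \<Rightarrow> (((nat ^ 'n) \<Rightarrow>\<^sub>0 complex) \<Rightarrow> complex) set" where
  "spec_points R =
     {x \<in> ring_hom R complex_ring \<inter> extensional (carrier R).
        \<forall>c. x (Poly_Mapping.single 0 c) = c}"

abbreviation near_in :: "'a::topological_space \<Rightarrow> 'a set \<Rightarrow> 'a filter" where
  "near_in x0 X \<equiv> inf (nhds x0) (principal X)"

text \<open>
  Membership in the local ring of the analytic space of \<open>Spec R\<close> at \<open>x0\<close>: locally, \<open>f\<close> is a
  holomorphic function of finitely many regular functions.  These spaces are reduced, so
  holomorphic germs are germs of functions.
\<close>

definition holomorphic_germ ::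
  "((nat ^ 'n::finite) \<Rightarrow>\<^sub>0 complex) ring \<Rightarrow> (((nat ^ 'n) \<Rightarrow>\<^sub>0 complex) \<Rightarrow> complex) \<Rightarrow>
   ((((nat ^ 'n) \<Rightarrow>\<^sub>0 complex) \<Rightarrow> complex) \<Rightarrow> complex) \<Rightarrow> bool" where
  "holomorphic_germ R x0 f \<longleftrightarrow>
     (\<exists>A F. finite A \<and> A \<subseteq> carrier R \<and> analytic_at_origin A F \<and>
        (\<forall>\<^sub>F x in near_in x0 (spec_points R). f x = F (\<lambda>a. x a - x0 a)))"

definition holomorphic_map_germ ::
  "((nat ^ 'n::finite) \<Rightarrow>\<^sub>0 complex) ring \<Rightarrow> (((nat ^ 'n) \<Rightarrow>\<^sub>0 complex) \<Rightarrow> complex) \<Rightarrow>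
   ((nat ^ 'n) \<Rightarrow>\<^sub>0 complex) ring \<Rightarrow> (((nat ^ 'n) \<Rightarrow>\<^sub>0 complex) \<Rightarrow> complex) \<Rightarrow>
   ((((nat ^ 'n) \<Rightarrow>\<^sub>0 complex) \<Rightarrow> complex) \<Rightarrow> (((nat ^ 'n) \<Rightarrow>\<^sub>0 complex) \<Rightarrow> complex)) \<Rightarrow> bool" where
  "holomorphic_map_germ R x0 R' x0' \<psi> \<longleftrightarrow>
     \<psi> x0 = x0' \<and>
     (\<forall>\<^sub>F x in near_in x0 (spec_points R). \<psi> x \<in> spec_points R') \<and>
     (\<forall>p\<in>carrier R'. holomorphic_germ R x0 (\<lambda>x. \<psi> x p))"

definition biholomorphic_germ ::
  "((nat ^ 'n::finite) \<Rightarrow>\<^sub>0 complex) ring \<Rightarrow> (((nat ^ 'n) \<Rightarrow>\<^sub>0 complex) \<Rightarrow> complex) \<Rightarrow>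
   ((nat ^ 'n) \<Rightarrow>\<^sub>0 complex) ring \<Rightarrow> (((nat ^ 'n) \<Rightarrow>\<^sub>0 complex) \<Rightarrow> complex) \<Rightarrow>
   ((((nat ^ 'n) \<Rightarrow>\<^sub>0 complex) \<Rightarrow> complex) \<Rightarrow> (((nat ^ 'n) \<Rightarrow>\<^sub>0 complex) \<Rightarrow> complex)) \<Rightarrow> bool" where
  "biholomorphic_germ R x0 R' x0' \<psi> \<longleftrightarrow>
     holomorphic_map_germ R x0 R' x0' \<psi> \<and>
     (\<exists>\<eta>. holomorphic_map_germ R' x0' R x0 \<eta> \<and>
        (\<forall>\<^sub>F x in near_in x0 (spec_points R). \<eta> (\<psi> x) = x) \<and>
        (\<forall>\<^sub>F x in near_in x0' (spec_points R'). \<psi> (\<eta> x) = x))"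

definition quotient_map ::
  "('n::finite \<Rightarrow> complex ^ 'k) \<Rightarrow> 'n set \<Rightarrow> complex ^ 'n \<Rightarrow> ((nat ^ 'n) \<Rightarrow>\<^sub>0 complex) \<Rightarrow> complex"
where
  "quotient_map \<Lambda> I w =
     (\<lambda>p\<in>carrier (resonance_algebra \<Lambda> I).
        \<Sum>\<alpha>\<in>Poly_Mapping.keys p. Poly_Mapping.lookup p \<alpha> * (\<Prod>j\<in>-I. w $ j ^ (\<alpha> $ j)))"

abbreviation vertex ::
  "('n::finite \<Rightarrow> complex ^ 'k) \<Rightarrow> 'n set \<Rightarrow> ((nat ^ 'n) \<Rightarrow>\<^sub>0 complex) \<Rightarrow> complex" where
  "vertex \<Lambda> I \<equiv> quotient_map \<Lambda> I 0"

text \<open>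
  A germ of biholomorphism \<open>\<phi>\<close> of \<open>(\<complex>^J, 0)\<close> respects the labels of the coordinates if it maps each
  hyperplane \<open>w\<^sub>j = 0\<close> to itself, that is, \<open>\<phi>\<^sub>j = w\<^sub>j u\<^sub>j\<close> with \<open>u\<^sub>j\<close> a holomorphic unit.  (A germ of
  this form is biholomorphic, its differential at \<open>0\<close> being diagonal with entries \<open>u\<^sub>j(0)\<close>.)
\<close>

definition label_preserving_germ ::
  "'n set \<Rightarrow> (complex ^ 'n::finite \<Rightarrow> complex ^ 'n) \<Rightarrow> bool" where
  "label_preserving_germ I \<phi> \<longleftrightarrow>
     (\<exists>u. (\<forall>j\<in>-I. u j 0 \<noteq> 0 \<and>
             analytic_at_origin (-I) (\<lambda>y. u j (\<chi> l. if l \<in> I then 0 else y l))) \<and>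
          (\<forall>\<^sub>F w in near_in 0 (carrier (coord_space (-I))). \<phi> w = (\<chi> j. w $ j * u j w)))"

text \<open>An isomorphism \<open>(\<phi>, \<psi>)\<close> of labelled quotient germs: \<open>\<psi> \<circ> q\<^sub>I = q'\<^sub>I \<circ> \<phi>\<close>.\<close>

definition labelled_quotient_iso ::
  "('n::finite \<Rightarrow> complex ^ 'k) \<Rightarrow> ('n \<Rightarrow> complex ^ 'l) \<Rightarrow> 'n set \<Rightarrow>
   (complex ^ 'n \<Rightarrow> complex ^ 'n) \<Rightarrow>
   ((((nat ^ 'n) \<Rightarrow>\<^sub>0 complex) \<Rightarrow> complex) \<Rightarrow> (((nat ^ 'n) \<Rightarrow>\<^sub>0 complex) \<Rightarrow> complex)) \<Rightarrow> bool" where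
  "labelled_quotient_iso \<Lambda> \<Lambda>' I \<phi> \<psi> \<longleftrightarrow>
     label_preserving_germ I \<phi> \<and>
     biholomorphic_germ (resonance_algebra \<Lambda> I) (vertex \<Lambda> I)
                        (resonance_algebra \<Lambda>' I) (vertex \<Lambda>' I) \<psi> \<and>
     (\<forall>\<^sub>F w in near_in 0 (carrier (coord_space (-I))).
        \<psi> (quotient_map \<Lambda> I w) = quotient_map \<Lambda>' I (\<phi> w))"


section \<open>The support coefficients and the logarithmic connection\<close>

text \<open>\<open>C\<^sub>I(\<alpha>)\<close>, as a vector of \<open>\<complex>^I\<close>.  It is well defined when \<open>\<alpha> \<in> M\<^sub>I\<close> and the \<open>\<Lambda>\<^sub>i\<close>, \<open>i \<in> I\<close>, are
  linearly independent.\<close>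

definition support_coeffs ::
  "('n::finite \<Rightarrow> complex ^ 'k) \<Rightarrow> 'n set \<Rightarrow> int ^ 'n \<Rightarrow> complex ^ 'n" where
  "support_coeffs \<Lambda> I \<alpha> =
     (THE c. c \<in> carrier (coord_space I) \<and>
        (\<Sum>j\<in>-I. of_int (\<alpha> $ j) *s \<Lambda> j) = (\<Sum>i\<in>I. c $ i *s \<Lambda> i))"

definition support_coeffs_ext ::
  "('n::finite \<Rightarrow> complex ^ 'k) \<Rightarrow> 'n set \<Rightarrow> complex ^ 'n \<Rightarrow> complex ^ 'n" where
  "support_coeffs_ext \<Lambda> I =
     (THE f. f \<in> extensional (resonance_space \<Lambda> I) \<and> clinear_on (resonance_space \<Lambda> I) f \<and>
        (\<forall>\<alpha>\<in>resonance_group \<Lambda> I. f (int_vec_to_complex \<alpha>) = support_coeffs \<Lambda> I \<alpha>))"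

text \<open>
  Sections of \<open>\<O> \<otimes> \<complex>[S\<^sub>I]\<close> on the torus \<open>(\<complex>\<^sup>*)^I\<close> are Laurent polynomials in the \<open>z\<^sub>i\<close> with
  coefficients in \<open>\<complex>[S\<^sub>I]\<close>: \<open>z^m \<otimes> f\<close> is \<open>Poly_Mapping.single m f\<close>.  The forms \<open>dz\<^sub>i / z\<^sub>i\<close>, \<open>i \<in> I\<close>,
  are a basis of the one-forms, and \<open>\<nabla>\<^sub>I s\<close> is given by its components in this basis;
  the component of \<open>ds\<close> is \<open>z\<^sub>i \<partial>s/\<partial>z\<^sub>i\<close>.
\<close>

definition torus_sections ::
  "('n::finite \<Rightarrow> complex ^ 'k) \<Rightarrow> 'n set \<Rightarrow> ((int ^ 'n) \<Rightarrow>\<^sub>0 ((nat ^ 'n) \<Rightarrow>\<^sub>0 complex)) set" where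
  "torus_sections \<Lambda> I =
     {s. \<forall>m\<in>Poly_Mapping.keys s. (\<forall>j. j \<notin> I \<longrightarrow> m $ j = 0) \<and>
           Poly_Mapping.lookup s m \<in> carrier (resonance_algebra \<Lambda> I)}"

definition support_derivation ::
  "('n::finite \<Rightarrow> complex ^ 'k) \<Rightarrow> 'n set \<Rightarrow> 'n \<Rightarrow>
   ((nat ^ 'n) \<Rightarrow>\<^sub>0 complex) \<Rightarrow> ((nat ^ 'n) \<Rightarrow>\<^sub>0 complex)" where
  "support_derivation \<Lambda> I i =
     Poly_Mapping.mapp (\<lambda>\<alpha> b. support_coeffs \<Lambda> I (nat_vec_to_int \<alpha>) $ i * b)"

definition log_connection ::
  "('n::finite \<Rightarrow> complex ^ 'k) \<Rightarrow> 'n set \<Rightarrow> ((int ^ 'n) \<Rightarrow>\<^sub>0 ((nat ^ 'n) \<Rightarrow>\<^sub>0 complex)) \<Rightarrow>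
   'n \<Rightarrow> ((int ^ 'n) \<Rightarrow>\<^sub>0 ((nat ^ 'n) \<Rightarrow>\<^sub>0 complex))" where
  "log_connection \<Lambda> I s =
     (\<lambda>i\<in>I. Poly_Mapping.mapp (\<lambda>m f. of_int (m $ i) * f) s
            - Poly_Mapping.map (support_derivation \<Lambda> I i) s)"

text \<open>An isomorphism \<open>\<theta> : \<complex>[S'\<^sub>I] \<rightarrow> \<complex>[S\<^sub>I]\<close> of \<open>\<complex>\<close>-algebras such that \<open>id \<otimes> \<theta>\<close> carries \<open>\<nabla>'\<^sub>I\<close> to \<open>\<nabla>\<^sub>I\<close>
  over the same labelled torus.\<close>

definition labelled_connection_iso ::
  "('n::finite \<Rightarrow> complex ^ 'k) \<Rightarrow> ('n \<Rightarrow> complex ^ 'l) \<Rightarrow> 'n set \<Rightarrow>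
   (((nat ^ 'n) \<Rightarrow>\<^sub>0 complex) \<Rightarrow> ((nat ^ 'n) \<Rightarrow>\<^sub>0 complex)) \<Rightarrow> bool" where
  "labelled_connection_iso \<Lambda> \<Lambda>' I \<theta> \<longleftrightarrow>
     \<theta> \<in> ring_iso (resonance_algebra \<Lambda>' I) (resonance_algebra \<Lambda> I) \<and>
     (\<forall>c. \<theta> (Poly_Mapping.single 0 c) = Poly_Mapping.single 0 c) \<and>
     (\<forall>s\<in>torus_sections \<Lambda>' I. \<forall>i\<in>I.
        Poly_Mapping.map \<theta> (log_connection \<Lambda>' I s i) =
        log_connection \<Lambda> I (Poly_Mapping.map \<theta> s) i)"

text \<open>
  Two configurations have the same labelled quotient germ and labelled connection, up to
  isomorphism.  The algebra \<open>\<complex>[S\<^sub>I]\<close> on which the connection acts is the coordinate ring of \<open>Q\<^sub>I\<close>,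
  so \<open>\<theta>\<close> is required to be the pullback of regular functions along \<open>\<psi>\<close>.
\<close>

definition same_labelled_data ::
  "('n::finite \<Rightarrow> complex ^ 'k) \<Rightarrow> ('n \<Rightarrow> complex ^ 'l) \<Rightarrow> 'n set \<Rightarrow> bool" where
  "same_labelled_data \<Lambda> \<Lambda>' I \<longleftrightarrow>
     (\<exists>\<phi> \<psi> \<theta>. labelled_quotient_iso \<Lambda> \<Lambda>' I \<phi> \<psi> \<and> labelled_connection_iso \<Lambda> \<Lambda>' I \<theta> \<and>
        (\<forall>p\<in>carrier (resonance_algebra \<Lambda>' I).
           \<forall>\<^sub>F x in near_in (vertex \<Lambda> I) (spec_points (resonance_algebra \<Lambda> I)). x (\<theta> p) = \<psi> x p))"


section \<open>The reconstructed configuration\<close>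

definition residual_space ::
  "('n::finite \<Rightarrow> complex ^ 'k) \<Rightarrow> 'n set \<Rightarrow> (complex, (complex ^ 'n) set) module" where
  "residual_space \<Lambda> I = quotient_space (coord_space (-I)) (resonance_space \<Lambda> I)"

definition residual_projection ::
  "('n::finite \<Rightarrow> complex ^ 'k) \<Rightarrow> 'n set \<Rightarrow> complex ^ 'n \<Rightarrow> (complex ^ 'n) set" where
  "residual_projection \<Lambda> I v = resonance_space \<Lambda> I +>\<^bsub>coord_space (-I)\<^esub> v"

definition linear_extension ::
  "('n::finite \<Rightarrow> complex ^ 'k) \<Rightarrow> 'n set \<Rightarrow> (complex ^ 'n \<Rightarrow> complex ^ 'n) \<Rightarrow> bool" where
  "linear_extension \<Lambda> I A \<longleftrightarrow>
     A \<in> carrier (coord_space (-I)) \<rightarrow> carrier (coord_space I) \<and>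
     clinear_on (carrier (coord_space (-I))) A \<and>
     (\<forall>v\<in>resonance_space \<Lambda> I. A v = support_coeffs_ext \<Lambda> I v)"

definition reconstructed_space ::
  "('n::finite \<Rightarrow> complex ^ 'k) \<Rightarrow> 'n set \<Rightarrow>
   (complex, (complex ^ 'n) \<times> (complex ^ 'n) set) module" where
  "reconstructed_space \<Lambda> I = direct_sum (coord_space I) (residual_space \<Lambda> I)"

definition reconstructed_weights ::
  "('n::finite \<Rightarrow> complex ^ 'k) \<Rightarrow> 'n set \<Rightarrow> (complex ^ 'n \<Rightarrow> complex ^ 'n) \<Rightarrow>
   'n \<Rightarrow> (complex ^ 'n) \<times> (complex ^ 'n) set" where
  "reconstructed_weights \<Lambda> I A j =
     (if j \<in> I then (axis j 1, \<zero>\<^bsub>residual_space \<Lambda> I\<^esub>)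
      else (A (axis j 1), residual_projection \<Lambda> I (axis j 1)))"

end

theory Submission
  imports Defs
begin

text \<open>
  Let \<open>E v = \<Sum>\<^sub>j v\<^sub>j \<Lambda>\<^sub>j\<close>.  A spanning configuration is determined up to linear equivalence by \<open>ker E\<close>.
  The projection of \<open>ker E\<close> to \<open>\<complex>^J\<close> is \<open>K = {v \<in> \<complex>^J. E v \<in> Span {\<Lambda>\<^sub>i : i \<in> I}}\<close>, which contains \<open>R\<^sub>I\<close>.
  The Krull dimension of \<open>\<complex>[S\<^sub>I]\<close> is at most \<open>dim R\<^sub>I\<close>: elements chosen along a chain of \<open>m\<close> proper
  inclusions of primes are algebraically independent, so that \<open>N^m\<close> monomials in them fit into the
  \<open>O(N^(dim R\<^sub>I))\<close> exponents of \<open>S\<^sub>I\<close> in a box of side \<open>O(N)\<close>.  Full resonance rank thus gives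
  \<open>dim R\<^sub>I \<ge> n - k = dim ker E\<close>, whence \<open>R\<^sub>I = K\<close> and \<open>ker E \<rightarrow> K\<close> is injective, which means that the
  support weights are independent and \<open>ker E = {r - C\<^sub>I r : r \<in> R\<^sub>I}\<close>.  This is also the kernel of the
  map \<open>v \<mapsto> (v\<^sub>I + A v\<^sub>J, \<pi> v\<^sub>J)\<close> defining the reconstructed weights.

  For the labelled data, the pullback \<open>p\<close> of \<open>X^\<alpha>\<close> is \<open>w^\<alpha>\<close> times a holomorphic unit.  Comparing growth
  along a curve \<open>w\<^sub>j = \<epsilon>^(m\<^sub>j)\<close> with generic weights \<open>m\<close> shows that \<open>X^\<alpha>\<close> occurs in \<open>p\<close>, so
  \<open>S'\<^sub>I \<subseteq> S\<^sub>I\<close>.  As \<open>p\<close> is an eigenvector of \<open>\<delta>\<^sub>i\<close> with eigenvalue \<open>c'\<^sub>i(\<alpha>)\<close>, the coefficients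
  \<open>C\<^sub>I\<close> and \<open>C'\<^sub>I\<close> agree on \<open>S'\<^sub>I\<close>, which gives \<open>ker E' \<subseteq> ker E\<close>; equality follows by comparing
  dimensions.
\<close>

subsection \<open>The monoid algebra and its Krull dimension\<close>

lemma carrier_monoid_algebra [simp]:
  "carrier (monoid_algebra S) = {p. Poly_Mapping.keys p \<subseteq> S}"
  by (simp add: monoid_algebra_def)

lemma monoid_algebra_simps [simp]:
  "x \<otimes>\<^bsub>monoid_algebra S\<^esub> y = x * y" "x \<oplus>\<^bsub>monoid_algebra S\<^esub> y = x + y"
  "\<zero>\<^bsub>monoid_algebra S\<^esub> = 0" "\<one>\<^bsub>monoid_algebra S\<^esub> = 1"
  by (simp_all add: monoid_algebra_def)

definition submonoid_exponents :: "(nat ^ 'n) set \<Rightarrow> bool" where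
  "submonoid_exponents S \<longleftrightarrow> 0 \<in> S \<and> (\<forall>a\<in>S. \<forall>b\<in>S. a + b \<in> S)"

lemma keys_single_zero_mult_subset:
  fixes p :: "(nat ^ 'n::finite) \<Rightarrow>\<^sub>0 complex"
  shows "Poly_Mapping.keys (Poly_Mapping.single 0 c * p) \<subseteq> Poly_Mapping.keys p"
  using keys_mult[of "Poly_Mapping.single 0 c" p] by (auto split: if_splits)

lemma keys_mult_subset:
  assumes "submonoid_exponents S" "Poly_Mapping.keys p \<subseteq> S" "Poly_Mapping.keys q \<subseteq> S"
  shows "Poly_Mapping.keys (p * q) \<subseteq> S"
  using keys_mult[of p q] assms unfolding submonoid_exponents_def by blast

lemma keys_power_subset:
  assumes "submonoid_exponents S" "Poly_Mapping.keys p \<subseteq> S"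
  shows "Poly_Mapping.keys (p ^ e) \<subseteq> S"
proof (induction e)
  case 0
  then show ?case using assms by (auto simp: submonoid_exponents_def)
next
  case (Suc e)
  then show ?case using keys_mult_subset[OF assms(1,2) Suc.IH] by simp
qed

lemma keys_add_subset:
  assumes "Poly_Mapping.keys p \<subseteq> S" "Poly_Mapping.keys q \<subseteq> S"
  shows "Poly_Mapping.keys (p + q) \<subseteq> S"
  using keys_add[of p q] assms by blast

lemma keys_sum_subset:
  assumes "\<And>x. x \<in> A \<Longrightarrow> Poly_Mapping.keys (f x) \<subseteq> S"
  shows "Poly_Mapping.keys (sum f A) \<subseteq> S"
  using keys_sum[of f A] assms by blast

lemma monoid_algebra_ideal_mult:
  assumes "ideal P (monoid_algebra S)" "p \<in> P" "Poly_Mapping.keys q \<subseteq> S"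
  shows "q * p \<in> P"
  using ideal.I_l_closed[OF assms(1,2), of q] assms(3) by simp

lemma monoid_algebra_ideal_add:
  assumes "ideal P (monoid_algebra S)" "p \<in> P" "q \<in> P"
  shows "p + q \<in> P"
  using additive_subgroup.a_closed[OF ideal.axioms(1)[OF assms(1)] assms(2,3)] by simp

lemma monoid_algebra_ideal_diff:
  assumes "ideal P (monoid_algebra S)" "p \<in> P" "q \<in> P" "0 \<in> S"
  shows "p - q \<in> P"
proof -
  \<comment> \<open>The constant -1 belongs to the algebra because the exponent 0 lies in
    \<open>S\<close>; this turns negation into multiplication by an element of the ring.\<close>
  have "Poly_Mapping.single 0 (-1) * q \<in> P"
    using assms by (intro monoid_algebra_ideal_mult) auto
  moreover have "Poly_Mapping.single 0 (-1) * q = - q"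
    by (simp add: single_uminus)
  ultimately show ?thesis
    using monoid_algebra_ideal_add[OF assms(1,2)] by fastforce
qed

lemma monoid_algebra_prime_power:
  assumes "primeideal P (monoid_algebra S)" "submonoid_exponents S"
    and "Poly_Mapping.keys p \<subseteq> S" "Poly_Mapping.keys q \<subseteq> S" "p \<notin> P" "p ^ e * q \<in> P"
  shows "q \<in> P"
  using assms(6)
proof (induction e)
  case 0
  then show ?case by simp
next
  case (Suc e)
  have "p * (p ^ e * q) \<in> P" using Suc.prems by (simp add: mult.assoc)
  then show ?case
    using primeideal.I_prime[OF assms(1), of p "p ^ e * q"] Suc.IH assms(2-5)
    by (simp add: keys_mult_subset keys_power_subset)
qed

section \<open>Monomials in elements chosen along a chain of primes\<close>

text \<open>The running index lets an induction strip the power of \<open>f i\<close> and continue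
  with the later members of the family.\<close>

fun power_product :: "(nat \<Rightarrow> 'a::comm_monoid_mult) \<Rightarrow> nat \<Rightarrow> nat list \<Rightarrow> 'a" where
  "power_product f i [] = 1"
| "power_product f i (e # es) = f i ^ e * power_product f (Suc i) es"

definition exponent_lists :: "nat \<Rightarrow> nat \<Rightarrow> nat list set" where
  "exponent_lists N j = {es. set es \<subseteq> {..<N} \<and> length es = j}"

lemma finite_exponent_lists [simp]: "finite (exponent_lists N j)"
  and card_exponent_lists: "card (exponent_lists N j) = N ^ j"
  using finite_lists_length_eq[of "{..<N}" j] card_lists_length_eq[of "{..<N}" j]
  by (simp_all add: exponent_lists_def)

lemma sum_exponent_lists_Suc:
  "(\<Sum>es\<in>exponent_lists N (Suc j). g es) =
     (\<Sum>e<N. \<Sum>es\<in>exponent_lists N j. g (e # es))"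
proof -
  have "exponent_lists N (Suc j) = (\<lambda>(e, es). e # es) ` ({..<N} \<times> exponent_lists N j)"
    by (force simp: exponent_lists_def length_Suc_conv)
  moreover have "inj_on (\<lambda>(e, es). e # es) ({..<N} \<times> exponent_lists N j)"
    by (auto simp: inj_on_def)
  ultimately show ?thesis
    by (simp add: sum.reindex sum.cartesian_product case_prod_unfold)
qed

lemma keys_power_product_subset:
  assumes "submonoid_exponents S" "\<And>l. l < m \<Longrightarrow> Poly_Mapping.keys (f l) \<subseteq> S" "i + length es \<le> m"
  shows "Poly_Mapping.keys (power_product f i es) \<subseteq> S"
  using assms(3)
proof (induction es arbitrary: i)
  case Nil
  then show ?case using assms by (simp add: submonoid_exponents_def)
next
  case (Cons e es)
  have "Poly_Mapping.keys (f i ^ e) \<subseteq> S"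
    using Cons.prems assms by (intro keys_power_subset) auto
  then show ?case
    using Cons.IH[of "Suc i"] Cons.prems assms(1) by (simp add: keys_mult_subset)
qed

text \<open>Modulo \<open>P\<^sub>i\<close> the lowest power of \<open>f\<^sub>i \<notin> P\<^sub>i\<close> can be cancelled from a relation; what is left is,
  modulo \<open>P\<^sub>i\<^sub>+\<^sub>1 \<ni> f\<^sub>i\<close>, a relation between monomials in the later \<open>f\<close>'s.\<close>

lemma chain_monomials_independent:
  fixes P :: "nat \<Rightarrow> ((nat ^ 'n::finite) \<Rightarrow>\<^sub>0 complex) set"
  assumes S: "submonoid_exponents S"
    and prime: "\<And>i. i \<le> m \<Longrightarrow> primeideal (P i) (monoid_algebra S)"
    and sub: "\<And>i. i < m \<Longrightarrow> P i \<subseteq> P (Suc i)"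
    and f: "\<And>i. i < m \<Longrightarrow> f i \<in> P (Suc i) - P i"
  shows "j \<le> m \<Longrightarrow>
    (\<Sum>es\<in>exponent_lists N j. Poly_Mapping.single 0 (a es) * power_product f (m - j) es) \<in> P (m - j)
    \<Longrightarrow> es \<in> exponent_lists N j \<Longrightarrow> a es = 0"
proof (induction j arbitrary: a es)
  case 0
  have es: "exponent_lists N 0 = {[]}" by (auto simp: exponent_lists_def)
  have id: "ideal (P m) (monoid_algebra S)" using prime[of m] by (simp add: primeideal_def)
  have mem: "Poly_Mapping.single 0 (a []) \<in> P m" using 0 es by simp
  show ?case
  \<comment> \<open>A nonzero constant is a unit, and a prime ideal is proper.\<close>
  proof (rule ccontr)
    assume "a es \<noteq> 0"
    then have nz: "a [] \<noteq> 0" using 0 es by simp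
    have "Poly_Mapping.single 0 (inverse (a [])) * Poly_Mapping.single 0 (a []) \<in> P m"
      by (rule monoid_algebra_ideal_mult[OF id mem]) (use S in \<open>auto simp: submonoid_exponents_def\<close>)
    then have "1 \<in> P m" using nz by (simp add: mult_single)
    then have "carrier (monoid_algebra S) = P m"
      using ideal.one_imp_carrier[OF id] by simp
    then show False using primeideal.I_notcarr[OF prime[of m]] by simp
  qed
next
  case (Suc j)
  \<comment> \<open>The given relation starts with \<open>f i\<close> and holds modulo
    \<open>P i\<close>; the induction hypothesis concerns relations starting with
    \<open>f (Suc i)\<close> modulo \<open>P (Suc i)\<close>.\<close>
  define i where "i = m - Suc j"
  have i: "i < m" "Suc i = m - j" using Suc.prems by (auto simp: i_def)
  have S0: "0 \<in> S" using S by (simp add: submonoid_exponents_def)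
  have id: "ideal (P l) (monoid_algebra S)" if "l \<le> m" for l
    using prime[OF that] by (simp add: primeideal_def)
  have Pc: "P l \<subseteq> {p. Poly_Mapping.keys p \<subseteq> S}" if "l \<le> m" for l
    using additive_subgroup.a_subset[OF ideal.axioms(1)[OF id[OF that]]] by simp
  have fk: "Poly_Mapping.keys (f l) \<subseteq> S" if "l < m" for l
    using f[OF that] Pc[of "Suc l"] that by auto
  \<comment> \<open>The relation is read as a polynomial in \<open>f i\<close> whose coefficients
    \<open>G e\<close> are combinations of monomials in the later elements.\<close>
  define G where "G e = (\<Sum>es\<in>exponent_lists N j.
      Poly_Mapping.single 0 (a (e # es)) * power_product f (Suc i) es)" for e
  have Gk: "Poly_Mapping.keys (G e) \<subseteq> S" for e
    unfolding G_def
  proof (rule keys_sum_subset)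
    fix es assume "es \<in> exponent_lists N j"
    then have "Suc i + length es \<le> m" using i Suc.prems by (simp add: exponent_lists_def)
    then show "Poly_Mapping.keys (Poly_Mapping.single 0 (a (e # es)) * power_product f (Suc i) es) \<subseteq> S"
      by (intro subset_trans[OF keys_single_zero_mult_subset] keys_power_product_subset[OF S fk])
  qed
  have total: "(\<Sum>e<N. f i ^ e * G e) \<in> P i"
    using Suc.prems(2) unfolding sum_exponent_lists_Suc i_def[symmetric] G_def
    by (simp add: sum_distrib_left mult_ac)
  \<comment> \<open>Strong induction on the power of \<open>f i\<close>: once the coefficients below
    \<open>e\<close> vanish, \<open>f i ^ e\<close> divides all that remains.\<close>
  have main: "\<forall>es\<in>exponent_lists N j. a (e # es) = 0" if "e < N" for e
    using that
  proof (induction e rule: less_induct)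
    case (less e)
    have G0: "G e' = 0" if "e' < e" for e'
      using less.IH[OF that] that less.prems by (simp add: G_def)
    define H where "H = (\<Sum>e'\<in>{Suc e..<N}. f i ^ (e' - Suc e) * G e')"
    have "{..<N} = {..<e} \<union> insert e {Suc e..<N}" using less.prems by auto
    moreover have "{..<e} \<inter> insert e {Suc e..<N} = {}" by auto
    ultimately have "(\<Sum>e<N. f i ^ e * G e) =
        (\<Sum>e'\<in>{..<e}. f i ^ e' * G e') + (\<Sum>e'\<in>insert e {Suc e..<N}. f i ^ e' * G e')"
      by (simp only: sum.union_disjoint finite_insert finite_lessThan finite_atLeastLessThan)
    also have "(\<Sum>e'\<in>{..<e}. f i ^ e' * G e') = 0" using G0 by simp
    also have "(\<Sum>e'\<in>insert e {Suc e..<N}. f i ^ e' * G e') =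
        f i ^ e * G e + (\<Sum>e'\<in>{Suc e..<N}. f i ^ e' * G e')" by simp
    also have "(\<Sum>e'\<in>{Suc e..<N}. f i ^ e' * G e') = f i ^ e * (f i * H)"
      unfolding H_def sum_distrib_left
    proof (rule sum.cong[OF refl])
      fix e' assume "e' \<in> {Suc e..<N}"
      then have "e + Suc (e' - Suc e) = e'" by simp
      then have "f i ^ e' = f i ^ e * (f i * f i ^ (e' - Suc e))"
        using power_add[of "f i" e "Suc (e' - Suc e)"] by simp
      then show "f i ^ e' * G e' = f i ^ e * (f i * (f i ^ (e' - Suc e) * G e'))"
        by (simp add: mult_ac)
    qed
    finally have eq: "f i ^ e * (G e + f i * H) \<in> P i" using total by (simp add: distrib_left)
    have Hk: "Poly_Mapping.keys H \<subseteq> S"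
      unfolding H_def by (intro keys_sum_subset keys_mult_subset[OF S] keys_power_subset[OF S] fk Gk i)
    \<comment> \<open>Since \<open>f i\<close> lies outside the prime \<open>P i\<close>, the factor
      \<open>f i ^ e\<close> cancels.\<close>
    have "G e + f i * H \<in> P i"
      using f[OF i(1)] i(1)
      by (intro monoid_algebra_prime_power[OF prime S _ _ _ eq] keys_add_subset keys_mult_subset[OF S]
          fk Gk Hk) auto
    then have 1: "G e + f i * H \<in> P (Suc i)" using subsetD[OF sub[OF i(1)]] by blast
    \<comment> \<open>The tail is a multiple of \<open>f i\<close>, which lies in
      \<open>P (Suc i)\<close>; modulo that ideal only \<open>G e\<close> survives.\<close>
    have "H * f i \<in> P (Suc i)"
      using f[OF i(1)] i(1) Hk by (intro monoid_algebra_ideal_mult[OF id]) auto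
    then have "(G e + f i * H) - H * f i \<in> P (Suc i)"
      using i by (intro monoid_algebra_ideal_diff[OF id _ _ S0] 1) auto
    then have "G e \<in> P (m - j)" using i by (simp add: mult.commute)
    then show ?case
      using Suc.IH[of "\<lambda>es. a (e # es)"] Suc.prems(1) unfolding G_def i by simp
  qed
  obtain e es' where "es = e # es'" "e < N" "es' \<in> exponent_lists N j"
    using Suc.prems(3) by (auto simp: exponent_lists_def length_Suc_conv)
  then show ?case using main by simp
qed

section \<open>Counting exponents in a box\<close>

text \<open>Take a determining set \<open>T\<close> of least size. Dropping any t from it lets some
  vector of \<open>V\<close> vanish on the rest of \<open>T\<close> but not at t. These vectors form
  a diagonal system on \<open>T\<close>, hence are independent, and there are as many as elements of
  \<open>T\<close>.\<close>

lemma subspace_determining_coordinates: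
  fixes V :: "('a::field ^ 'n::finite) set"
  assumes V: "vec.subspace V"
  shows "\<exists>T. card T \<le> vec.dim V \<and> (\<forall>v\<in>V. (\<forall>t\<in>T. v $ t = 0) \<longrightarrow> v = 0)"
proof -
  define det where "det T \<longleftrightarrow> (\<forall>v\<in>V. (\<forall>t\<in>T. v $ t = 0) \<longrightarrow> v = 0)" for T :: "'n set"
  have "det UNIV" by (simp add: det_def vec_eq_iff)
  then obtain T where T: "det T" and least: "\<And>T'. det T' \<Longrightarrow> card T \<le> card T'"
    using ex_has_least_nat[of det UNIV card] by blast
  have "\<exists>v\<in>V. (\<forall>s\<in>T - {t}. v $ s = 0) \<and> v $ t \<noteq> 0" if "t \<in> T" for t
  proof -
    have "card (T - {t}) < card T" by (rule card_Diff1_less[OF finite that])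
    then have "\<not> det (T - {t})" using least[of "T - {t}"] by auto
    then obtain v where v: "v \<in> V" "\<forall>s\<in>T - {t}. v $ s = 0" "v \<noteq> 0" unfolding det_def by blast
    then have "v $ t \<noteq> 0" using T unfolding det_def by blast
    then show ?thesis using v by blast
  qed
  then obtain b where b: "\<forall>t\<in>T. b t \<in> V \<and> (\<forall>s\<in>T - {t}. b t $ s = 0) \<and> b t $ t \<noteq> 0"
    by metis
  then have bV: "\<And>t. t \<in> T \<Longrightarrow> b t \<in> V" and bt: "\<And>t. t \<in> T \<Longrightarrow> b t $ t \<noteq> 0"
    and b0: "\<And>s t. s \<in> T \<Longrightarrow> t \<in> T \<Longrightarrow> s \<noteq> t \<Longrightarrow> b t $ s = 0"
    by auto
  have inj: "inj_on b T"
    by (rule inj_onI) (metis b0 bt)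
  have "vec.independent (b ` T)"
  proof (rule vec.independent_if_scalars_zero)
    fix u x assume u: "(\<Sum>x\<in>b ` T. u x *s x) = 0" and "x \<in> b ` T"
    then obtain t where t: "t \<in> T" "x = b t" by blast
    have "(\<Sum>s\<in>T. u (b s) *s b s) = 0" using u by (simp add: sum.reindex[OF inj])
    then have "(\<Sum>s\<in>T. u (b s) * b s $ t) = 0"
      by (simp add: vec_eq_iff)
    moreover have "\<forall>s\<in>T - {t}. b s $ t = 0" using b0 t by auto
    then have "(\<Sum>s\<in>T. u (b s) * b s $ t) = u (b t) * b t $ t"
      by (simp add: sum.remove[OF finite t(1)])
    ultimately show "u x = 0" using bt[OF t(1)] t by simp
  qed simp
  then have "card (b ` T) \<le> vec.dim V"
    using bV by (intro vec.independent_card_le_dim) auto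
  then show ?thesis using T inj unfolding det_def by (auto simp: card_image)
qed

definition box :: "nat \<Rightarrow> (nat ^ 'n::finite) set" where
  "box c = {\<alpha>. \<forall>t. \<alpha> $ t \<le> c}"

lemma finite_box: "finite (box c)"
proof -
  have "box c \<subseteq> vec_lambda ` (PiE UNIV (\<lambda>_. {..c}))"
  proof
    fix \<alpha> :: "nat ^ 'n" assume "\<alpha> \<in> box c"
    then have "vec_nth \<alpha> \<in> PiE UNIV (\<lambda>_. {..c})" by (auto simp: box_def)
    then show "\<alpha> \<in> vec_lambda ` (PiE UNIV (\<lambda>_. {..c}))" by (metis image_eqI vec_nth_inverse)
  qed
  then show ?thesis by (rule finite_subset) (intro finite_imageI finite_PiE; simp)
qed

text \<open>An exponent lying in \<open>V\<close> is determined by at most \<open>vec.dim V\<close>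
  of its coordinates, and each of these takes \<open>c + 1\<close> values.\<close>

lemma card_box_subspace_le:
  fixes S :: "(nat ^ 'n::finite) set" and V :: "(complex ^ 'n) set"
  assumes V: "vec.subspace V"
    and S: "\<And>\<alpha>. \<alpha> \<in> S \<Longrightarrow> int_vec_to_complex (nat_vec_to_int \<alpha>) \<in> V"
  shows "card (S \<inter> box c) \<le> (c + 1) ^ vec.dim V"
proof -
  obtain T where T: "card T \<le> vec.dim V" and det: "\<And>v. v \<in> V \<Longrightarrow> \<forall>t\<in>T. v $ t = 0 \<Longrightarrow> v = 0"
    using subspace_determining_coordinates[OF V] by blast
  have "inj_on (\<lambda>\<alpha>. \<lambda>t\<in>T. \<alpha> $ t) (S \<inter> box c)"
  proof (rule inj_onI)
    fix \<alpha> \<beta> :: "nat ^ 'n"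
    assume a: "\<alpha> \<in> S \<inter> box c" "\<beta> \<in> S \<inter> box c" and eq: "(\<lambda>t\<in>T. \<alpha> $ t) = (\<lambda>t\<in>T. \<beta> $ t)"
    have "\<alpha> $ t = \<beta> $ t" if "t \<in> T" for t using fun_cong[OF eq, of t] that by simp
    then have "int_vec_to_complex (nat_vec_to_int \<alpha>) - int_vec_to_complex (nat_vec_to_int \<beta>) = 0"
      using a by (intro det vec.subspace_diff[OF V] S)
        (auto simp: int_vec_to_complex_def nat_vec_to_int_def)
    then show "\<alpha> = \<beta>"
      by (simp add: vec_eq_iff int_vec_to_complex_def nat_vec_to_int_def)
  qed
  moreover have "(\<lambda>\<alpha>. \<lambda>t\<in>T. \<alpha> $ t) ` (S \<inter> box c) \<subseteq> PiE T (\<lambda>_. {..c})"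
    by (auto simp: box_def)
  ultimately have "card (S \<inter> box c) \<le> card (PiE T (\<lambda>_. {..c}))"
    by (intro card_inj_on_le) (auto intro!: finite_PiE)
  also have "\<dots> = (c + 1) ^ card T" by (simp add: card_PiE)
  also have "\<dots> \<le> (c + 1) ^ vec.dim V" using T by (intro power_increasing) auto
  finally show ?thesis .
qed

lemma keys_mult_box:
  assumes "Poly_Mapping.keys p \<subseteq> box a" "Poly_Mapping.keys q \<subseteq> box b"
  shows "Poly_Mapping.keys (p * q) \<subseteq> box (a + b)"
proof
  fix \<gamma> assume "\<gamma> \<in> Poly_Mapping.keys (p * q)"
  then obtain \<alpha> \<beta> where "\<gamma> = \<alpha> + \<beta>" "\<alpha> \<in> box a" "\<beta> \<in> box b"
    using keys_mult[of p q] assms by blast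
  then show "\<gamma> \<in> box (a + b)" by (auto simp: box_def add_mono)
qed

lemma keys_power_box:
  assumes "Poly_Mapping.keys p \<subseteq> box a"
  shows "Poly_Mapping.keys (p ^ e) \<subseteq> box (e * a)"
proof (induction e)
  case 0
  then show ?case by (auto simp: box_def)
next
  case (Suc e)
  then show ?case using keys_mult_box[OF assms Suc.IH] by simp
qed

lemma keys_power_product_box:
  assumes "\<And>l. l < m \<Longrightarrow> Poly_Mapping.keys (f l) \<subseteq> box D" "i + length es \<le> m" "set es \<subseteq> {..<N}"
  shows "Poly_Mapping.keys (power_product f i es) \<subseteq> box (length es * (N * D))"
  using assms(2,3)
proof (induction es arbitrary: i)
  case Nil
  then show ?case by (auto simp: box_def)
next
  case (Cons e es)
  have "Poly_Mapping.keys (f i ^ e) \<subseteq> box (e * D)"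
    using Cons.prems assms(1) by (intro keys_power_box) auto
  moreover have "box (e * D) \<subseteq> (box (N * D) :: (nat ^ 'a) set)"
    using Cons.prems by (auto simp: box_def intro: order_trans[OF _ mult_le_mono1])
  ultimately have "Poly_Mapping.keys (f i ^ e) \<subseteq> box (N * D)" by blast
  then have "Poly_Mapping.keys (f i ^ e * power_product f (Suc i) es) \<subseteq>
      box (N * D + length es * (N * D))"
    using Cons by (intro keys_mult_box) auto
  then show ?case by simp
qed

text \<open>Scalars act as constant polynomials, so that the bound on the size of independent
  families in a span becomes available for polynomials.\<close>

interpretation poly_mapping: vector_space
  "\<lambda>c (p :: (nat ^ 'n::finite) \<Rightarrow>\<^sub>0 complex). Poly_Mapping.single 0 c * p"
  by unfold_locales
    (simp_all add: distrib_left distrib_right single_add mult_single mult.assoc[symmetric])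

lemma sum_singles:
  "(\<Sum>\<alpha>\<in>Poly_Mapping.keys p. Poly_Mapping.single \<alpha> (Poly_Mapping.lookup p \<alpha>)) = p"
proof (rule poly_mapping_eqI)
  fix \<beta>
  show "Poly_Mapping.lookup
      (\<Sum>\<alpha>\<in>Poly_Mapping.keys p. Poly_Mapping.single \<alpha> (Poly_Mapping.lookup p \<alpha>)) \<beta> =
      Poly_Mapping.lookup p \<beta>"
    by (cases "\<beta> \<in> Poly_Mapping.keys p")
      (auto simp: lookup_sum lookup_single when_def in_keys_iff)
qed

lemma krull_dim_monoid_algebra_le:
  fixes S :: "(nat ^ 'n::finite) set" and V :: "(complex ^ 'n) set"
  assumes S: "submonoid_exponents S" and V: "vec.subspace V"
    and SV: "\<And>\<alpha>. \<alpha> \<in> S \<Longrightarrow> int_vec_to_complex (nat_vec_to_int \<alpha>) \<in> V"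
  shows "krull_dim (monoid_algebra S) \<le> enat (vec.dim V)"
  unfolding krull_dim_def
proof (rule Sup_least, safe)
  fix m and P :: "nat \<Rightarrow> ((nat ^ 'n) \<Rightarrow>\<^sub>0 complex) set"
  assume prime: "\<forall>i\<le>m. primeideal (P i) (monoid_algebra S)" and sub: "\<forall>i<m. P i \<subset> P (Suc i)"
  have "\<exists>f. \<forall>i<m. f i \<in> P (Suc i) - P i" using sub by (intro choice) blast
  then obtain f where f: "\<And>i. i < m \<Longrightarrow> f i \<in> P (Suc i) - P i" by blast
  have fS: "Poly_Mapping.keys (f i) \<subseteq> S" if "i < m" for i
  proof -
    have "ideal (P (Suc i)) (monoid_algebra S)" using prime that by (simp add: primeideal_def)
    then show ?thesis
      using additive_subgroup.a_subset[OF ideal.axioms(1)] f[OF that] by fastforce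
  qed
  \<comment> \<open>A crude common bound: each coordinate of each exponent occurring in some
    \<open>f i\<close> is one of the nonnegative summands.\<close>
  define D where "D = (\<Sum>i<m. \<Sum>\<alpha>\<in>Poly_Mapping.keys (f i). \<Sum>t\<in>UNIV. \<alpha> $ t)"
  have fD: "Poly_Mapping.keys (f i) \<subseteq> box D" if "i < m" for i
  proof
    fix \<alpha> assume \<alpha>: "\<alpha> \<in> Poly_Mapping.keys (f i)"
    have "\<alpha> $ t \<le> D" for t
    proof -
      have "\<alpha> $ t \<le> (\<Sum>t\<in>UNIV. \<alpha> $ t)" by (rule member_le_sum) auto
      also have "\<dots> \<le> (\<Sum>\<alpha>\<in>Poly_Mapping.keys (f i). \<Sum>t\<in>UNIV. \<alpha> $ t)"
        by (rule member_le_sum[OF \<alpha>]) auto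
      also have "\<dots> \<le> D" unfolding D_def using that by (intro member_le_sum) auto
      finally show ?thesis .
    qed
    then show "\<alpha> \<in> box D" by (simp add: box_def)
  qed
  show "enat m \<le> enat (vec.dim V)"
  proof (rule ccontr)
    assume "\<not> enat m \<le> enat (vec.dim V)"
    then have m: "vec.dim V < m" by simp
    \<comment> \<open>Monomials with powers below \<open>N\<close> have exponents in a box of side
      \<open>m * (N * D)\<close>, which holds at most \<open>(N * (m * D + 1)) ^ vec.dim V\<close>,
      that is \<open>N ^ vec.dim V * C\<close>, exponents of \<open>S\<close>. Any positive
      \<open>N\<close> above \<open>C\<close> makes this less than \<open>N ^ m\<close>.\<close>
    define C where "C = (m * D + 1) ^ vec.dim V"
    define N where "N = C + 1"
    let ?L = "exponent_lists N m" and ?g = "power_product f 0"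
    let ?B = "S \<inter> box (m * (N * D))"
    have indep: "a es = 0"
      if "(\<Sum>es\<in>?L. Poly_Mapping.single 0 (a es) * ?g es) = 0" "es \<in> ?L" for a es
    proof (rule chain_monomials_independent[OF S, where P = P and f = f and m = m and j = m and N = N and es = es])
      \<comment> \<open>The first prime contains 0, so a relation in the algebra is also one modulo
        \<open>P 0\<close>, where the chain lemma starts.\<close>
      have "ideal (P 0) (monoid_algebra S)" using prime by (simp add: primeideal_def)
      then have "0 \<in> P 0"
        using additive_subgroup.zero_closed[OF ideal.axioms(1)] by fastforce
      then show "(\<Sum>es\<in>?L. Poly_Mapping.single 0 (a es) * power_product f (m - m) es) \<in> P (m - m)"
        using that by simp
    qed (use prime sub f that in auto)
    \<comment> \<open>The products must be counted without repetition. Two equal ones would give a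
      relation with coefficients 1 and -1.\<close>
    have inj: "inj_on ?g ?L"
    proof (rule inj_onI, rule ccontr)
      fix x y assume xy: "x \<in> ?L" "y \<in> ?L" "?g x = ?g y" "x \<noteq> y"
      define a :: "nat list \<Rightarrow> complex" where "a es = (if es = x then 1 else if es = y then -1 else 0)" for es
      have "(\<Sum>es\<in>?L. Poly_Mapping.single 0 (a es) * ?g es) =
          (\<Sum>es\<in>{x, y}. Poly_Mapping.single 0 (a es) * ?g es)"
        using xy by (intro sum.mono_neutral_right) (auto simp: a_def)
      also have "\<dots> = 0" using xy by (simp add: a_def single_uminus)
      finally show False using indep[of a x] xy by (simp add: a_def)
    qed
    have "poly_mapping.independent (?g ` ?L)"
    proof (rule poly_mapping.independent_if_scalars_zero)
      fix u x
      assume u: "(\<Sum>x\<in>?g ` ?L. Poly_Mapping.single 0 (u x) * x) = 0" and "x \<in> ?g ` ?L"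
      then obtain es where "es \<in> ?L" "x = ?g es" by blast
      then show "u x = 0"
        using indep[of "\<lambda>es. u (?g es)" es] u by (simp add: sum.reindex[OF inj])
    qed simp
    moreover have "?g ` ?L \<subseteq> poly_mapping.span ((\<lambda>\<beta>. Poly_Mapping.single \<beta> 1) ` ?B)"
    proof safe
      fix es assume es: "es \<in> ?L"
      have "Poly_Mapping.keys (?g es) \<subseteq> S"
        using es by (intro keys_power_product_subset[OF S fS]) (auto simp: exponent_lists_def)
      moreover have "Poly_Mapping.keys (?g es) \<subseteq> box (length es * (N * D))"
        using es by (intro keys_power_product_box[OF fD]) (auto simp: exponent_lists_def)
      ultimately have keys: "Poly_Mapping.keys (?g es) \<subseteq> ?B"
        using es by (simp add: exponent_lists_def)
      have "(\<Sum>\<alpha>\<in>Poly_Mapping.keys (?g es). Poly_Mapping.single 0 (Poly_Mapping.lookup (?g es) \<alpha>) *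
          Poly_Mapping.single \<alpha> 1) \<in> poly_mapping.span ((\<lambda>\<beta>. Poly_Mapping.single \<beta> 1) ` ?B)"
        using keys by (intro poly_mapping.span_sum poly_mapping.span_scale poly_mapping.span_base) auto
      then show "?g es \<in> poly_mapping.span ((\<lambda>\<beta>. Poly_Mapping.single \<beta> 1) ` ?B)"
        by (simp add: mult_single sum_singles)
    qed
    ultimately have "card (?g ` ?L) \<le> card ((\<lambda>\<beta>. Poly_Mapping.single \<beta> (1::complex)) ` ?B)"
      using poly_mapping.independent_span_bound[of "(\<lambda>\<beta>. Poly_Mapping.single \<beta> 1) ` ?B" "?g ` ?L"]
      by (simp add: finite_box)
    also have "\<dots> \<le> card ?B" by (intro card_image_le) (simp add: finite_box)
    also have "\<dots> \<le> (m * (N * D) + 1) ^ vec.dim V" by (rule card_box_subspace_le[OF V SV])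
    also have "\<dots> \<le> (N * (m * D + 1)) ^ vec.dim V"
      by (intro power_mono) (simp_all add: N_def algebra_simps)
    also have "\<dots> = N ^ vec.dim V * C" by (simp only: C_def power_mult_distrib)
    also have "\<dots> < N ^ vec.dim V * N" by (simp add: N_def)
    also have "\<dots> = N ^ Suc (vec.dim V)" by simp
    also have "\<dots> \<le> N ^ m" using m by (intro power_increasing) (simp_all add: N_def)
    also have "\<dots> = card (?g ` ?L)" by (simp add: card_image[OF inj] card_exponent_lists)
    finally show False by simp
  qed
qed

subsection \<open>Linear relations between the weights\<close>

lemma carrier_coord_space: "v \<in> carrier (coord_space K) \<longleftrightarrow> (\<forall>i. i \<notin> K \<longrightarrow> v $ i = 0)"
  by (simp add: coord_space_def)

lemma subspace_coord_space: "vec.subspace (carrier (coord_space K))"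
  by (auto simp: vec.subspace_def carrier_coord_space)

definition weight_sum :: "('n::finite \<Rightarrow> complex ^ 'k) \<Rightarrow> complex ^ 'n \<Rightarrow> complex ^ 'k" where
  "weight_sum \<Lambda> v = (\<Sum>j\<in>UNIV. v $ j *s \<Lambda> j)"

definition restrict_coords :: "'n set \<Rightarrow> complex ^ 'n \<Rightarrow> complex ^ 'n" where
  "restrict_coords K v = (\<chi> j. if j \<in> K then v $ j else 0)"

lemma linear_weight_sum: "Vector_Spaces.linear (*s) (*s) (weight_sum \<Lambda>)"
  unfolding weight_sum_def
  by unfold_locales
    (simp_all add: vec.scale_left_distrib sum.distrib vec.scale_sum_right)

lemma linear_restrict_coords: "Vector_Spaces.linear (*s) (*s) (restrict_coords K)"
  unfolding restrict_coords_def by unfold_locales (simp_all add: vec_eq_iff)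

lemmas weight_sum_add = vec.linear_add[OF linear_weight_sum]
  and weight_sum_diff = vec.linear_diff[OF linear_weight_sum]
  and weight_sum_scale = vec.linear_scale[OF linear_weight_sum]
  and weight_sum_0 = vec.linear_0[OF linear_weight_sum]

lemma weight_sum_axis [simp]: "weight_sum \<Lambda> (axis j 1) = \<Lambda> j"
proof -
  have "weight_sum \<Lambda> (axis j 1) = (\<Sum>i\<in>UNIV. if i = j then \<Lambda> i else 0)"
    unfolding weight_sum_def by (intro sum.cong) (auto simp: axis_def)
  then show ?thesis by simp
qed

lemma weight_sum_coord_space:
  assumes "v \<in> carrier (coord_space K)"
  shows "weight_sum \<Lambda> v = (\<Sum>j\<in>K. v $ j *s \<Lambda> j)"
  unfolding weight_sum_def using assms
  by (intro sum.mono_neutral_right) (auto simp: carrier_coord_space)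

lemma restrict_coords_mem [simp]: "restrict_coords K v \<in> carrier (coord_space K)"
  by (simp add: restrict_coords_def carrier_coord_space)

lemma restrict_coords_id: "v \<in> carrier (coord_space K) \<Longrightarrow> restrict_coords K v = v"
  by (auto simp: restrict_coords_def carrier_coord_space vec_eq_iff)

lemma restrict_coords_complement:
  "v \<in> carrier (coord_space K) \<Longrightarrow> restrict_coords (- K) v = 0"
  by (auto simp: restrict_coords_def carrier_coord_space vec_eq_iff)

lemma restrict_coords_split: "restrict_coords K v + restrict_coords (- K) v = v"
  by (auto simp: restrict_coords_def vec_eq_iff)

lemma axis_mem_coord_space [simp]: "axis j 1 \<in> carrier (coord_space K) \<longleftrightarrow> j \<in> K"
  by (auto simp: carrier_coord_space axis_def)

lemma range_weight_sum:
  assumes "vec.span (range \<Lambda>) = UNIV"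
  shows "range (weight_sum \<Lambda>) = UNIV"
proof -
  have "vec.span (range \<Lambda>) \<subseteq> range (weight_sum \<Lambda>)"
  proof (rule vec.span_minimal)
    show "range \<Lambda> \<subseteq> range (weight_sum \<Lambda>)" by (metis image_subsetI rangeI weight_sum_axis)
    show "vec.subspace (range (weight_sum \<Lambda>))"
      by (intro vec.linear_subspace_image linear_weight_sum vec.subspace_UNIV)
  qed
  then show ?thesis using assms by blast
qed

lemma span_weights:
  "vec.span (\<Lambda> ` K) = weight_sum \<Lambda> ` carrier (coord_space K)"
proof
  show "vec.span (\<Lambda> ` K) \<subseteq> weight_sum \<Lambda> ` carrier (coord_space K)"
  proof (rule vec.span_minimal)
    show "\<Lambda> ` K \<subseteq> weight_sum \<Lambda> ` carrier (coord_space K)"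
    proof safe
      fix i assume "i \<in> K"
      then show "\<Lambda> i \<in> weight_sum \<Lambda> ` carrier (coord_space K)"
        by (intro image_eqI[of _ _ "axis i 1"]) auto
    qed
    show "vec.subspace (weight_sum \<Lambda> ` carrier (coord_space K))"
      by (intro vec.linear_subspace_image linear_weight_sum subspace_coord_space)
  qed
  show "weight_sum \<Lambda> ` carrier (coord_space K) \<subseteq> vec.span (\<Lambda> ` K)"
  proof safe
    fix c assume "c \<in> carrier (coord_space K)"
    then have "weight_sum \<Lambda> c = (\<Sum>j\<in>K. c $ j *s \<Lambda> j)" by (rule weight_sum_coord_space)
    also have "\<dots> \<in> vec.span (\<Lambda> ` K)"
      by (intro vec.span_sum vec.span_scale vec.span_base imageI)
    finally show "weight_sum \<Lambda> c \<in> vec.span (\<Lambda> ` K)" .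
  qed
qed

text \<open>Double annihilator: a vector outside the span is separated from it by a linear
  functional, and every functional on \<complex>^k is the pairing with some t.\<close>

lemma mem_span_if_annihilated:
  fixes x :: "complex ^ 'k::finite"
  assumes "\<And>t. (\<And>y. y \<in> B \<Longrightarrow> pairing y t = 0) \<Longrightarrow> pairing x t = 0"
  shows "x \<in> vec.span B"
proof (rule ccontr)
  assume x: "x \<notin> vec.span B"
  obtain C where "C \<subseteq> B" and ind: "vec.independent C" and "B \<subseteq> vec.span C"
    using vec.maximal_independent_subset[of B] by blast
  then have C: "vec.span C = vec.span B"
    by (intro subset_antisym vec.span_mono vec.span_minimal vec.subspace_span)
  from ind x have "vec.independent (insert x C)" by (simp add: C vec.independent_insert)
  then obtain g :: "complex ^ 'k \<Rightarrow> complex ^ 'k" where g: "Vector_Spaces.linear (*s) (*s) g"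
    and gC: "\<forall>y\<in>insert x C. g y = (if y = x then 1 else 0)"
    using vec.linear_independent_extend[of "insert x C" "\<lambda>y. if y = x then 1 else 0"] by blast
  have g0: "g y = 0" if "y \<in> vec.span B" for y
  proof (rule vec.linear_eq_0_on_span[OF g, of C])
    show "y \<in> vec.span C" using that C by simp
    show "g z = 0" if "z \<in> C" for z
      using gC x C that by (metis insertI2 vec.span_base)
  qed
  \<comment> \<open>The vector \<open>1\<close> has all coordinates equal to 1, so every row of the
    matrix of \<open>g\<close> gives a functional that is 1 at \<open>x\<close> and 0 on the span;
    any coordinate may be chosen.\<close>
  define a :: 'k where "a = undefined"
  define t where "t = matrix g $ a"
  have t: "pairing y t = g y $ a" for y
  proof -
    have "g y $ a = (matrix g *v y) $ a" by (simp add: matrix_works[OF g])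
    then show ?thesis by (simp add: pairing_def t_def matrix_vector_mult_def mult.commute)
  qed
  have "pairing x t = 0"
    by (rule assms) (simp add: t g0 vec.span_base)
  then show False using gC by (simp add: t)
qed

text \<open>This is the space K of the overview: the complex form of the resonance condition, with
  vanishing on the isotropy algebra replaced by membership in the span of the support
  weights.\<close>

definition residual_relations :: "('n::finite \<Rightarrow> complex ^ 'k::finite) \<Rightarrow> 'n set \<Rightarrow> (complex ^ 'n) set" where
  "residual_relations \<Lambda> I =
     {v \<in> carrier (coord_space (- I)). weight_sum \<Lambda> v \<in> vec.span (\<Lambda> ` I)}"

lemma subspace_residual_relations: "vec.subspace (residual_relations \<Lambda> I)"
  using subspace_coord_space[of "- I"] vec.subspace_span[of "\<Lambda> ` I"]
  by (auto simp: residual_relations_def vec.subspace_def weight_sum_add weight_sum_scale weight_sum_0)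

text \<open>The weight sum of a resonance vanishes on the common kernel of the support weights,
  hence lies in their span by the double annihilator.\<close>

lemma resonance_mem_residual_relations:
  assumes "\<alpha> \<in> resonances \<Lambda> I"
  shows "int_vec_to_complex (nat_vec_to_int \<alpha>) \<in> residual_relations \<Lambda> I"
proof -
  let ?v = "int_vec_to_complex (nat_vec_to_int \<alpha>)"
  have v: "?v $ j = of_nat (\<alpha> $ j)" for j
    by (simp add: int_vec_to_complex_def nat_vec_to_int_def)
  have mem: "?v \<in> carrier (coord_space (- I))"
    using assms by (simp add: resonances_def carrier_coord_space v)
  have "weight_sum \<Lambda> ?v \<in> vec.span (\<Lambda> ` I)"
  proof (rule mem_span_if_annihilated)
    fix t assume "\<And>y. y \<in> \<Lambda> ` I \<Longrightarrow> pairing y t = 0"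
    then have "t \<in> isotropy \<Lambda> I" by (simp add: isotropy_def)
    then have "(\<Sum>j\<in>- I. of_nat (\<alpha> $ j) * pairing (\<Lambda> j) t) = 0"
      using assms by (simp add: resonances_def)
    moreover have "pairing (weight_sum \<Lambda> ?v) t = (\<Sum>j\<in>- I. of_nat (\<alpha> $ j) * pairing (\<Lambda> j) t)"
      unfolding weight_sum_coord_space[OF mem] pairing_def v
      by (simp add: sum_distrib_left sum_distrib_right mult_ac sum.swap[of _ "- I"])
    ultimately show "pairing (weight_sum \<Lambda> ?v) t = 0" by simp
  qed
  then show ?thesis using mem by (simp add: residual_relations_def)
qed

lemma submonoid_resonances: "submonoid_exponents (resonances \<Lambda> I)"
  by (auto simp: submonoid_exponents_def resonances_def distrib_right sum.distrib)

lemma int_vec_to_complex_diff: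
  "int_vec_to_complex (x - y) = int_vec_to_complex x - int_vec_to_complex y"
  by (simp add: int_vec_to_complex_def vec_eq_iff)

lemma resonance_group_mem_residual_relations:
  assumes "\<gamma> \<in> resonance_group \<Lambda> I"
  shows "int_vec_to_complex \<gamma> \<in> residual_relations \<Lambda> I"
  using assms unfolding resonance_group_def
  by (auto simp: int_vec_to_complex_diff
      intro!: vec.subspace_diff[OF subspace_residual_relations] resonance_mem_residual_relations)

lemma resonance_space_subset: "resonance_space \<Lambda> I \<subseteq> residual_relations \<Lambda> I"
  unfolding resonance_space_def
  using resonance_group_mem_residual_relations
  by (intro vec.span_minimal subspace_residual_relations) blast

lemma resonance_in_resonance_group:
  assumes "\<alpha> \<in> resonances \<Lambda> I"
  shows "nat_vec_to_int \<alpha> \<in> resonance_group \<Lambda> I"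
proof -
  have "0 \<in> resonances \<Lambda> I" using submonoid_resonances by (auto simp: submonoid_exponents_def)
  moreover have "nat_vec_to_int \<alpha> = nat_vec_to_int \<alpha> - nat_vec_to_int 0"
    by (simp add: nat_vec_to_int_def vec_eq_iff)
  ultimately show ?thesis using assms unfolding resonance_group_def by blast
qed

text \<open>A linear right inverse \<open>g\<close> of the surjective \<open>weight_sum\<close> has
  a range of dimension k that meets the kernel only in 0.\<close>

lemma dim_kernel_weight_sum:
  fixes \<Lambda> :: "'n::finite \<Rightarrow> complex ^ 'k::finite"
  assumes "vec.span (range \<Lambda>) = UNIV"
  shows "vec.dim {v. weight_sum \<Lambda> v = 0} + CARD('k) \<le> CARD('n)"
proof -
  obtain g where g: "Vector_Spaces.linear (*s) (*s) g" and Eg: "\<And>x. weight_sum \<Lambda> (g x) = x"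
    using vec.linear_surjective_right_inverse[OF linear_weight_sum[of \<Lambda>]] range_weight_sum[OF assms]
    by (metis comp_apply id_apply)
  let ?K = "{v. weight_sum \<Lambda> v = 0}"
  have K: "vec.subspace ?K"
    by (auto simp: vec.subspace_def weight_sum_add weight_sum_scale weight_sum_0)
  have G: "vec.subspace (range g)"
    by (intro vec.linear_subspace_image g vec.subspace_UNIV)
  have "?K \<inter> range g = {0}"
    using Eg vec.linear_0[OF g] by (force simp: weight_sum_0)
  moreover have "vec.dim (range g) = CARD('k)"
  proof -
    have "inj_on g (vec.span UNIV)" by (rule inj_on_inverseI[of _ "weight_sum \<Lambda>"]) (rule Eg)
    then show ?thesis using vec.dim_image_eq[OF g, of UNIV] by (simp add: card_cart_basis)
  qed
  ultimately have "vec.dim ?K + CARD('k) = vec.dim {x + y |x y. x \<in> ?K \<and> y \<in> range g}"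
    using vec.dim_sums_Int[OF K G] by simp
  also have "\<dots> \<le> CARD('n)" by (rule dim_subset_UNIV_cart_gen)
  finally show ?thesis .
qed

section \<open>Consequences of full resonance rank\<close>

text \<open>With E = \<open>weight_sum\<close>, the dimensions satisfy dim ker E \<le> dim R \<le>
  dim K \<le> dim ker E, from the Krull bound, the inclusion of R in K, and the projection of ker E
  onto K. Equality throughout gives R = K and makes the projection injective on ker E.\<close>

lemma full_resonance_rank_consequences:
  fixes \<Lambda> :: "'n::finite \<Rightarrow> complex ^ 'k::finite"
  assumes span: "vec.span (range \<Lambda>) = UNIV" and full: "full_resonance_rank \<Lambda> I"
  shows resonance_space_eq: "resonance_space \<Lambda> I = residual_relations \<Lambda> I"
    and support_weights_independent:
      "\<And>c. c \<in> carrier (coord_space I) \<Longrightarrow> weight_sum \<Lambda> c = 0 \<Longrightarrow> c = 0"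
proof -
  let ?K = "{v. weight_sum \<Lambda> v = 0}" and ?p = "restrict_coords (- I)"
  have K: "vec.subspace ?K"
    by (auto simp: vec.subspace_def weight_sum_add weight_sum_scale weight_sum_0)
  have "krull_dim (resonance_algebra \<Lambda> I) \<le> enat (vec.dim (resonance_space \<Lambda> I))"
    using resonance_in_resonance_group
    by (intro krull_dim_monoid_algebra_le submonoid_resonances)
      (auto simp: resonance_space_def intro!: vec.span_base)
  then have "enat CARD('n) \<le> enat (vec.dim (resonance_space \<Lambda> I)) + enat CARD('k)"
    using full unfolding full_resonance_rank_def by (metis add_right_mono)
  then have 1: "vec.dim ?K \<le> vec.dim (resonance_space \<Lambda> I)"
    using dim_kernel_weight_sum[OF span] by simp
  have image: "?p ` ?K = residual_relations \<Lambda> I"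
  proof safe
    fix v assume "weight_sum \<Lambda> v = 0"
    then have "weight_sum \<Lambda> (?p v) = weight_sum \<Lambda> (restrict_coords I (- v))"
      using weight_sum_add[of \<Lambda> "restrict_coords I v" "?p v"] restrict_coords_split[of I v]
      by (simp add: vec.linear_neg[OF linear_restrict_coords] vec.linear_neg[OF linear_weight_sum]
          eq_neg_iff_add_eq_0 add.commute)
    then show "?p v \<in> residual_relations \<Lambda> I"
      by (auto simp: residual_relations_def span_weights)
  next
    fix v assume v: "v \<in> residual_relations \<Lambda> I"
    then obtain c where c: "c \<in> carrier (coord_space I)" "weight_sum \<Lambda> v = weight_sum \<Lambda> c"
      by (auto simp: residual_relations_def span_weights)
    \<comment> \<open>Subtracting the support vector \<open>c\<close> turns \<open>v\<close> into a
      relation and leaves its residual coordinates unchanged.\<close>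
    have "?p (v - c) = v"
      using c v by (simp add: vec.linear_diff[OF linear_restrict_coords] restrict_coords_complement
          restrict_coords_id residual_relations_def)
    moreover have "v - c \<in> ?K" using c by (simp add: weight_sum_diff)
    ultimately show "v \<in> ?p ` ?K" by (metis image_eqI)
  qed
  have 2: "vec.dim (residual_relations \<Lambda> I) \<le> vec.dim ?K"
    using vec.dim_image_le[OF linear_restrict_coords, of "- I" ?K] by (simp add: image)
  show eq: "resonance_space \<Lambda> I = residual_relations \<Lambda> I"
    using 1 2 by (intro vec.subspace_dim_equal resonance_space_subset subspace_residual_relations)
      (auto simp: resonance_space_def)
  \<comment> \<open>Injectivity of the projection is obtained through a linear section: its image of
    K has the full dimension of the kernel, so every relation is \<open>g\<close> of its residual
    part. A relation supported in \<open>I\<close> has residual part 0.\<close>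
  obtain g where g: "Vector_Spaces.linear (*s) (*s) g" "range g \<subseteq> ?K"
    and pg: "\<forall>v\<in>?p ` ?K. ?p (g v) = v"
    using vec.linear_exists_right_inverse_on[OF linear_restrict_coords[of "- I"] K] by blast
  let ?G = "g ` residual_relations \<Lambda> I"
  have "inj_on g (vec.span (residual_relations \<Lambda> I))"
    using pg unfolding image vec.span_eq_iff[THEN iffD2, OF subspace_residual_relations]
    by (intro inj_on_inverseI[of _ ?p]) blast
  then have "vec.dim ?G = vec.dim (residual_relations \<Lambda> I)"
    by (rule vec.dim_image_eq[OF g(1)])
  then have G: "?G = ?K"
    using 1 eq g by (intro vec.subspace_dim_equal K vec.linear_subspace_image subspace_residual_relations) auto
  fix c assume c: "c \<in> carrier (coord_space I)" "weight_sum \<Lambda> c = 0"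
  then obtain r where r: "r \<in> residual_relations \<Lambda> I" "c = g r" using G by blast
  then have "r = ?p c" using pg image by simp
  also have "\<dots> = 0" using c by (intro restrict_coords_complement)
  finally show "c = 0" using vec.linear_0[OF g(1)] r(2) by simp
qed

section \<open>Support coefficients and linear extensions\<close>

locale full_rank_support =
  fixes \<Lambda> :: "'n::finite \<Rightarrow> complex ^ 'k::finite" and I :: "'n set"
  assumes spanning: "vec.span (range \<Lambda>) = UNIV"
    and full_rank: "full_resonance_rank \<Lambda> I"
begin

lemmas resonance_space_eq = full_resonance_rank_consequences(1)[OF spanning full_rank]
  and support_independent = full_resonance_rank_consequences(2)[OF spanning full_rank]

lemma support_sum_inj:
  assumes "c \<in> carrier (coord_space I)" "c' \<in> carrier (coord_space I)"
    and "weight_sum \<Lambda> c = weight_sum \<Lambda> c'"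
  shows "c = c'"
  using support_independent[of "c - c'"] assms
  by (simp add: weight_sum_diff vec.subspace_diff[OF subspace_coord_space])

text \<open>Existence is the equality of \<open>resonance_space\<close> with
  \<open>residual_relations\<close>; uniqueness is the independence of the support weights.\<close>

lemma ex1_support_coeffs:
  assumes "v \<in> resonance_space \<Lambda> I"
  shows "\<exists>!c. c \<in> carrier (coord_space I) \<and> weight_sum \<Lambda> v = weight_sum \<Lambda> c"
  using assms support_sum_inj
  by (auto simp: resonance_space_eq residual_relations_def span_weights)

lemma support_coeffs:
  assumes \<alpha>: "\<alpha> \<in> resonance_group \<Lambda> I"
  shows "support_coeffs \<Lambda> I \<alpha> \<in> carrier (coord_space I)" (is ?mem)
    and "weight_sum \<Lambda> (int_vec_to_complex \<alpha>) = weight_sum \<Lambda> (support_coeffs \<Lambda> I \<alpha>)" (is ?eq)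
proof -
  have mem: "int_vec_to_complex \<alpha> \<in> carrier (coord_space (- I))"
    using resonance_group_mem_residual_relations[OF \<alpha>] by (simp add: residual_relations_def)
  have P: "(c \<in> carrier (coord_space I) \<and>
        (\<Sum>j\<in>-I. of_int (\<alpha> $ j) *s \<Lambda> j) = (\<Sum>i\<in>I. c $ i *s \<Lambda> i)) \<longleftrightarrow>
      (c \<in> carrier (coord_space I) \<and> weight_sum \<Lambda> (int_vec_to_complex \<alpha>) = weight_sum \<Lambda> c)" for c
    using weight_sum_coord_space[OF mem, of \<Lambda>] weight_sum_coord_space[of c I \<Lambda>]
    by (auto simp: int_vec_to_complex_def)
  have "int_vec_to_complex \<alpha> \<in> resonance_space \<Lambda> I"
    using \<alpha> by (simp add: resonance_space_def vec.span_base)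
  from theI'[OF ex1_support_coeffs[OF this]] show ?mem ?eq
    unfolding support_coeffs_def P by blast+
qed

text \<open>The map \<open>f\<close> sending a vector of the resonance space to its unique support
  coefficients meets the description defining \<open>support_coeffs_ext\<close>. It is the only such
  map, because linear maps that agree on the resonance group agree on its span.\<close>

lemma support_coeffs_ext:
  assumes "v \<in> resonance_space \<Lambda> I"
  shows "support_coeffs_ext \<Lambda> I v \<in> carrier (coord_space I)" (is ?mem)
    and "weight_sum \<Lambda> v = weight_sum \<Lambda> (support_coeffs_ext \<Lambda> I v)" (is ?eq)
proof -
  let ?R = "resonance_space \<Lambda> I"
  define good where "good f \<longleftrightarrow> f \<in> extensional ?R \<and> clinear_on ?R f \<and>
      (\<forall>\<alpha>\<in>resonance_group \<Lambda> I. f (int_vec_to_complex \<alpha>) = support_coeffs \<Lambda> I \<alpha>)"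
    for f :: "complex ^ 'n \<Rightarrow> complex ^ 'n"
  have R: "vec.subspace ?R" by (simp add: resonance_space_def)
  define f where "f = (\<lambda>v\<in>?R. THE c. c \<in> carrier (coord_space I) \<and> weight_sum \<Lambda> v = weight_sum \<Lambda> c)"
  have f: "f v \<in> carrier (coord_space I) \<and> weight_sum \<Lambda> v = weight_sum \<Lambda> (f v)" if "v \<in> ?R" for v
    using theI'[OF ex1_support_coeffs[OF that]] that by (simp add: f_def)
  have fI: "f v = c"
    if "v \<in> ?R" "c \<in> carrier (coord_space I)" "weight_sum \<Lambda> v = weight_sum \<Lambda> c" for v c
    using f[OF that(1)] that by (intro support_sum_inj) auto
  have "good f"
    unfolding good_def
  proof (intro conjI ballI)
    show "f \<in> extensional ?R" by (simp add: f_def)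
    show "clinear_on ?R f"
      unfolding clinear_on_def
    proof (intro conjI ballI allI)
      fix x y assume "x \<in> ?R" "y \<in> ?R"
      then show "f (x + y) = f x + f y"
        using f[of x] f[of y] by (intro fI)
          (auto simp: weight_sum_add vec.subspace_add[OF R] vec.subspace_add[OF subspace_coord_space])
    next
      fix c x assume "x \<in> ?R"
      then show "f (c *s x) = c *s f x"
        using f[of x] by (intro fI)
          (auto simp: weight_sum_scale vec.subspace_scale[OF R] vec.subspace_scale[OF subspace_coord_space])
    qed
    fix \<alpha> assume "\<alpha> \<in> resonance_group \<Lambda> I"
    then show "f (int_vec_to_complex \<alpha>) = support_coeffs \<Lambda> I \<alpha>"
      using support_coeffs by (intro fI) (auto simp: resonance_space_def vec.span_base)
  qed
  moreover have "g = f" if "good g" for g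
  proof
    fix v
    have gf: "{v \<in> ?R. g v = f v} = ?R"
    proof -
      have "vec.subspace {v \<in> ?R. g v = f v}"
      proof (rule vec.subspaceI)
        \<comment> \<open>\<open>clinear_on\<close> speaks only of sums and multiples, so the value
          at 0 is found by scaling with 0.\<close>
        have "g (0 *s 0) = 0 *s g 0" "f (0 *s 0) = 0 *s f 0"
          using that \<open>good f\<close> R unfolding good_def clinear_on_def
          by (meson vec.subspace_0)+
        then show "0 \<in> {v \<in> ?R. g v = f v}" using vec.subspace_0[OF R] by simp
      next
        fix x y assume "x \<in> {v \<in> ?R. g v = f v}" "y \<in> {v \<in> ?R. g v = f v}"
        then show "x + y \<in> {v \<in> ?R. g v = f v}"
          using that \<open>good f\<close> vec.subspace_add[OF R] unfolding good_def clinear_on_def by simp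
      next
        fix c x assume "x \<in> {v \<in> ?R. g v = f v}"
        then show "c *s x \<in> {v \<in> ?R. g v = f v}"
          using that \<open>good f\<close> vec.subspace_scale[OF R] unfolding good_def clinear_on_def by simp
      qed
      moreover have "int_vec_to_complex ` resonance_group \<Lambda> I \<subseteq> {v \<in> ?R. g v = f v}"
        using that \<open>good f\<close> unfolding good_def by (auto simp: resonance_space_def vec.span_base)
      ultimately have "?R \<subseteq> {v \<in> ?R. g v = f v}"
        unfolding resonance_space_def by (intro vec.span_minimal)
      then show ?thesis by blast
    qed
    show "g v = f v"
    proof (cases "v \<in> ?R")
      case True
      then show ?thesis using gf by blast
    next
      case False
      then show ?thesis using that \<open>good f\<close> unfolding good_def extensional_def by simp
    qed
  qed
  ultimately have "(THE f. good f) = f" by blast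
  then have "support_coeffs_ext \<Lambda> I = f" by (simp add: support_coeffs_ext_def good_def)
  then show ?mem ?eq using f[OF assms] by auto
qed

text \<open>A linear map \<open>L\<close> taking each support weight \<Lambda>_i to e_i inverts
  \<open>weight_sum\<close> on \<complex>^I. Composed with \<open>weight_sum\<close> it is defined
  on all of \<complex>^J and reads off the support coefficients on the resonance space.\<close>

lemma ex_linear_extension: "\<exists>A. linear_extension \<Lambda> I A"
proof -
  have inj: "inj_on \<Lambda> I"
  proof (rule inj_onI)
    fix i j assume "i \<in> I" "j \<in> I" "\<Lambda> i = \<Lambda> j"
    then have "axis i (1::complex) = axis j 1" by (intro support_sum_inj) auto
    then show "i = j" by (simp add: axis_eq_axis)
  qed
  have "vec.independent (\<Lambda> ` I)"
  proof (rule vec.independent_if_scalars_zero)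
    fix u x assume u: "(\<Sum>x\<in>\<Lambda> ` I. u x *s x) = 0" and "x \<in> \<Lambda> ` I"
    then obtain i where i: "i \<in> I" "x = \<Lambda> i" by blast
    define c where "c = restrict_coords I (\<chi> i. u (\<Lambda> i))"
    have "weight_sum \<Lambda> c = (\<Sum>i\<in>I. u (\<Lambda> i) *s \<Lambda> i)"
      unfolding c_def weight_sum_coord_space[OF restrict_coords_mem]
      by (intro sum.cong) (auto simp: restrict_coords_def)
    then have "c = 0" using u unfolding sum.reindex[OF inj]
      by (intro support_independent) (auto simp: c_def)
    then have "c $ i = 0" by simp
    then show "u x = 0" using i by (simp add: c_def restrict_coords_def)
  qed simp
  then obtain L where L: "Vector_Spaces.linear (*s) (*s) L"
    and L_image: "\<forall>x\<in>\<Lambda> ` I. L x = axis (inv_into I \<Lambda> x) (1::complex)"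
    using vec.linear_independent_extend[of "\<Lambda> ` I" "\<lambda>x. axis (inv_into I \<Lambda> x) 1"] by blast
  \<comment> \<open>The projection puts the values into \<complex>^I whatever \<open>L\<close> does
    away from the span of the support weights.\<close>
  define A where "A v = restrict_coords I (L (weight_sum \<Lambda> v))" for v
  have L_support: "L (weight_sum \<Lambda> c) = c" if "c \<in> carrier (coord_space I)" for c
  proof -
    have "L (weight_sum \<Lambda> c) = (\<Sum>i\<in>I. c $ i *s axis i 1)"
      unfolding weight_sum_coord_space[OF that] vec.linear_sum[OF L] vec.linear_scale[OF L]
      using L_image inj by (intro sum.cong) (auto simp: inv_into_f_f)
    also have "\<dots> = weight_sum (\<lambda>i. axis i 1) c"
      by (rule weight_sum_coord_space[OF that, symmetric])
    also have "\<dots> = c" by (simp add: weight_sum_def basis_expansion)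
    finally show ?thesis .
  qed
  have "linear_extension \<Lambda> I A"
    unfolding linear_extension_def
  proof (intro conjI ballI)
    show "A \<in> carrier (coord_space (- I)) \<rightarrow> carrier (coord_space I)" by (simp add: A_def)
    show "clinear_on (carrier (coord_space (- I))) A"
      by (simp add: clinear_on_def A_def weight_sum_add weight_sum_scale vec.linear_add[OF L]
          vec.linear_scale[OF L] vec.linear_add[OF linear_restrict_coords]
          vec.linear_scale[OF linear_restrict_coords])
    show "A v = support_coeffs_ext \<Lambda> I v" if "v \<in> resonance_space \<Lambda> I" for v
      using support_coeffs_ext[OF that] by (simp add: A_def L_support restrict_coords_id)
  qed
  then show ?thesis by blast
qed

end

subsection \<open>The reconstructed configuration\<close>

text \<open>Both spaces are the same quotient of \<complex>^n, and \<open>T\<close> sends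
  \<open>B x\<close> to \<open>B' x\<close>. The kernel condition is stated through fibres because
  \<open>V\<close> and \<open>W\<close> are records without assumed axioms.\<close>

lemma linearly_equivalent_if_same_kernel:
  fixes B :: "complex ^ 'n::finite \<Rightarrow> 'v" and B' :: "complex ^ 'n \<Rightarrow> 'w"
  assumes range: "range B = carrier V" "range B' = carrier W"
    and add: "\<And>x y. B (x + y) = B x \<oplus>\<^bsub>V\<^esub> B y" "\<And>x y. B' (x + y) = B' x \<oplus>\<^bsub>W\<^esub> B' y"
    and scale: "\<And>c x. B (c *s x) = c \<odot>\<^bsub>V\<^esub> B x" "\<And>c x. B' (c *s x) = c \<odot>\<^bsub>W\<^esub> B' x"
    and kernel: "\<And>x y. B x = B y \<longleftrightarrow> B' x = B' y"
  shows "linearly_equivalent V (\<lambda>i. B (axis i 1)) W (\<lambda>i. B' (axis i 1))"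
proof -
  \<comment> \<open>The choice of preimage is immaterial, since \<open>B'\<close> is constant on the
    fibres of \<open>B\<close>.\<close>
  define T where "T v = B' (SOME x. B x = v)" for v
  have T: "T (B x) = B' x" for x
    unfolding T_def by (subst kernel[symmetric]) (rule someI[of _ x], simp)
  have "bij_betw T (carrier V) (carrier W)"
    unfolding bij_betw_def range[symmetric]
    by (auto simp: inj_on_def T kernel image_iff)
  moreover have "\<forall>x\<in>carrier V. \<forall>y\<in>carrier V. T (x \<oplus>\<^bsub>V\<^esub> y) = T x \<oplus>\<^bsub>W\<^esub> T y"
    unfolding range[symmetric] by (auto simp: T add(1)[symmetric] add(2))
  moreover have "\<forall>c. \<forall>x\<in>carrier V. T (c \<odot>\<^bsub>V\<^esub> x) = c \<odot>\<^bsub>W\<^esub> T x"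
    unfolding range[symmetric] by (auto simp: T scale(1)[symmetric] scale(2))
  ultimately show ?thesis
    unfolding linearly_equivalent_def using T by blast
qed

lemma coord_space_ops [simp]:
  "x \<oplus>\<^bsub>coord_space K\<^esub> y = x + y" "c \<odot>\<^bsub>coord_space K\<^esub> x = c *s x" "\<zero>\<^bsub>coord_space K\<^esub> = 0"
  by (simp_all add: coord_space_def)

lemma carrier_coord_space_UNIV [simp]: "carrier (coord_space UNIV) = UNIV"
  by (simp add: coord_space_def)

lemma residual_projection_eq: "residual_projection \<Lambda> I v = {r + v |r. r \<in> resonance_space \<Lambda> I}"
  unfolding residual_projection_def a_r_coset_def' by auto

lemma subspace_resonance_space: "vec.subspace (resonance_space \<Lambda> I)"
  by (simp add: resonance_space_def)

lemma residual_projection_eq_iff: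
  "residual_projection \<Lambda> I v = residual_projection \<Lambda> I w \<longleftrightarrow> v - w \<in> resonance_space \<Lambda> I"
proof
  assume "residual_projection \<Lambda> I v = residual_projection \<Lambda> I w"
  moreover have "v \<in> residual_projection \<Lambda> I v"
    using vec.subspace_0[OF subspace_resonance_space] by (force simp: residual_projection_eq)
  ultimately show "v - w \<in> resonance_space \<Lambda> I" by (auto simp: residual_projection_eq)
next
  have sub: "residual_projection \<Lambda> I v \<subseteq> residual_projection \<Lambda> I w"
    if "v - w \<in> resonance_space \<Lambda> I" for v w
  proof
    fix x assume "x \<in> residual_projection \<Lambda> I v"
    then obtain r where "r \<in> resonance_space \<Lambda> I" "x = r + v" by (auto simp: residual_projection_eq)
    then have "r + (v - w) \<in> resonance_space \<Lambda> I" "x = (r + (v - w)) + w"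
      using that vec.subspace_add[OF subspace_resonance_space] by auto
    then show "x \<in> residual_projection \<Lambda> I w" unfolding residual_projection_eq by blast
  qed
  assume "v - w \<in> resonance_space \<Lambda> I"
  moreover from this have "w - v \<in> resonance_space \<Lambda> I"
    using vec.subspace_neg[OF subspace_resonance_space] by fastforce
  ultimately show "residual_projection \<Lambda> I v = residual_projection \<Lambda> I w"
    using sub by blast
qed

lemma residual_projection_0: "residual_projection \<Lambda> I 0 = \<zero>\<^bsub>residual_space \<Lambda> I\<^esub>"
  by (simp add: residual_projection_eq residual_space_def quotient_space_def)

lemma residual_projection_add:
  "residual_projection \<Lambda> I (v + w) =
     residual_projection \<Lambda> I v \<oplus>\<^bsub>residual_space \<Lambda> I\<^esub> residual_projection \<Lambda> I w"
proof -
  have "residual_projection \<Lambda> I v \<oplus>\<^bsub>residual_space \<Lambda> I\<^esub> residual_projection \<Lambda> I w =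
      {x + y |x y. x \<in> residual_projection \<Lambda> I v \<and> y \<in> residual_projection \<Lambda> I w}"
    by (auto simp: residual_space_def quotient_space_def set_add_def')
  also have "\<dots> = residual_projection \<Lambda> I (v + w)"
  proof (intro subset_antisym subsetI)
    fix z assume "z \<in> residual_projection \<Lambda> I (v + w)"
    then obtain r where "r \<in> resonance_space \<Lambda> I" "z = (r + v) + (0 + w)"
      by (auto simp: residual_projection_eq add_ac)
    then show "z \<in> {x + y |x y. x \<in> residual_projection \<Lambda> I v \<and> y \<in> residual_projection \<Lambda> I w}"
      using vec.subspace_0[OF subspace_resonance_space] unfolding residual_projection_eq by blast
  next
    fix z assume "z \<in> {x + y |x y. x \<in> residual_projection \<Lambda> I v \<and> y \<in> residual_projection \<Lambda> I w}"
    then obtain r s where "r \<in> resonance_space \<Lambda> I" "s \<in> resonance_space \<Lambda> I" "z = (r + s) + (v + w)"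
      by (auto simp: residual_projection_eq add_ac)
    then show "z \<in> residual_projection \<Lambda> I (v + w)"
      using vec.subspace_add[OF subspace_resonance_space] unfolding residual_projection_eq by blast
  qed
  finally show ?thesis ..
qed

lemma residual_projection_scale:
  "residual_projection \<Lambda> I (c *s v) = c \<odot>\<^bsub>residual_space \<Lambda> I\<^esub> residual_projection \<Lambda> I v"
proof -
  have "c \<odot>\<^bsub>residual_space \<Lambda> I\<^esub> residual_projection \<Lambda> I v =
      (\<Union>x\<in>residual_projection \<Lambda> I v. residual_projection \<Lambda> I (c *s x))"
    by (simp add: residual_space_def quotient_space_def residual_projection_def)
  \<comment> \<open>All cosets in the union coincide, and the index set is nonempty because it
    contains \<open>v\<close>.\<close>
  also have "\<dots> = (\<Union>x\<in>residual_projection \<Lambda> I v. residual_projection \<Lambda> I (c *s v))"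
  proof (intro SUP_cong refl)
    fix x assume "x \<in> residual_projection \<Lambda> I v"
    then have "x - v \<in> resonance_space \<Lambda> I" by (auto simp: residual_projection_eq)
    then have "c *s (x - v) \<in> resonance_space \<Lambda> I"
      by (rule vec.subspace_scale[OF subspace_resonance_space])
    then show "residual_projection \<Lambda> I (c *s x) = residual_projection \<Lambda> I (c *s v)"
      by (simp add: residual_projection_eq_iff vec.scale_right_diff_distrib)
  qed
  also have "\<dots> = residual_projection \<Lambda> I (c *s v)"
    using vec.subspace_0[OF subspace_resonance_space] by (force simp: residual_projection_eq)
  finally show ?thesis ..
qed

text \<open>The linear map on \<complex>^n that takes e_j to the reconstructed weight of index j: it
  plays the role for the reconstructed configuration that \<open>weight_sum\<close> plays for the
  original one.\<close>

definition reconstruction ::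
  "('n::finite \<Rightarrow> complex ^ 'k) \<Rightarrow> 'n set \<Rightarrow> (complex ^ 'n \<Rightarrow> complex ^ 'n) \<Rightarrow>
   complex ^ 'n \<Rightarrow> (complex ^ 'n) \<times> (complex ^ 'n) set" where
  "reconstruction \<Lambda> I A v =
     (restrict_coords I v + A (restrict_coords (- I) v),
      residual_projection \<Lambda> I (restrict_coords (- I) v))"

context full_rank_support
begin

lemma reconstruction_axis:
  assumes "linear_extension \<Lambda> I A"
  shows "(\<lambda>j. reconstruction \<Lambda> I A (axis j 1)) = reconstructed_weights \<Lambda> I A"
proof
  fix j
  have "A (0 *s 0) = 0 *s A 0"
    using assms unfolding linear_extension_def clinear_on_def
    by (meson vec.subspace_0 subspace_coord_space)
  then have A0: "A 0 = 0" by simp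
  show "reconstruction \<Lambda> I A (axis j 1) = reconstructed_weights \<Lambda> I A j"
    using restrict_coords_id[of "axis j 1" I] restrict_coords_complement[of "axis j 1" I]
      restrict_coords_id[of "axis j 1" "- I"] restrict_coords_complement[of "axis j 1" "- I"]
    by (cases "j \<in> I") (simp_all add: reconstruction_def reconstructed_weights_def A0
        residual_projection_0)
qed

text \<open>For the difference z the second component says that z_J lies in the resonance space.
  There \<open>A\<close> gives the support coefficients, so the first component says that z_I is
  their negative, which is the relation E z = 0.\<close>

lemma reconstruction_kernel:
  assumes A: "linear_extension \<Lambda> I A"
  shows "reconstruction \<Lambda> I A x = reconstruction \<Lambda> I A y \<longleftrightarrow> weight_sum \<Lambda> x = weight_sum \<Lambda> y"
proof -
  let ?p = "restrict_coords I" and ?q = "restrict_coords (- I)"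
  define z where "z = x - y"
  have lin: "clinear_on (carrier (coord_space (- I))) A"
    and AR: "\<And>v. v \<in> resonance_space \<Lambda> I \<Longrightarrow> A v = support_coeffs_ext \<Lambda> I v"
    using A by (auto simp: linear_extension_def)
  have "A (?q x) = A (?q y + ?q z)"
    by (simp add: z_def vec.linear_diff[OF linear_restrict_coords])
  also have "\<dots> = A (?q y) + A (?q z)" using lin by (simp add: clinear_on_def)
  finally have Aq: "A (?q x) = A (?q y) + A (?q z)" .
  have "reconstruction \<Lambda> I A x = reconstruction \<Lambda> I A y \<longleftrightarrow>
      ?p z + A (?q z) = 0 \<and> ?q z \<in> resonance_space \<Lambda> I"
    by (auto simp: reconstruction_def residual_projection_eq_iff Aq z_def algebra_simps
        vec.linear_diff[OF linear_restrict_coords])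
  also have "\<dots> \<longleftrightarrow> weight_sum \<Lambda> z = 0"
  proof
    assume "?p z + A (?q z) = 0 \<and> ?q z \<in> resonance_space \<Lambda> I"
    then have "weight_sum \<Lambda> (?q z) = weight_sum \<Lambda> (A (?q z))" and "weight_sum \<Lambda> (?p z + A (?q z)) = 0"
      using support_coeffs_ext(2) AR by (auto simp: weight_sum_0)
    then have "weight_sum \<Lambda> (?p z + ?q z) = 0" by (simp add: weight_sum_add)
    then show "weight_sum \<Lambda> z = 0" by (simp add: restrict_coords_split)
  next
    assume z: "weight_sum \<Lambda> z = 0"
    have sum: "weight_sum \<Lambda> (?p z) + weight_sum \<Lambda> (?q z) = 0"
      using z by (simp add: weight_sum_add[symmetric] restrict_coords_split)
    then have "weight_sum \<Lambda> (?q z) = weight_sum \<Lambda> (- ?p z)"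
      by (simp add: vec.linear_neg[OF linear_weight_sum] eq_neg_iff_add_eq_0 add.commute)
    then have R: "?q z \<in> resonance_space \<Lambda> I"
      unfolding resonance_space_eq residual_relations_def span_weights
      by (auto intro!: imageI vec.subspace_neg[OF subspace_coord_space])
    have "weight_sum \<Lambda> (?p z + A (?q z)) = 0"
      using sum support_coeffs_ext(2)[OF R] AR[OF R] by (simp add: weight_sum_add)
    moreover have "?p z + A (?q z) \<in> carrier (coord_space I)"
      using support_coeffs_ext(1)[OF R] AR[OF R] by (simp add: vec.subspace_add[OF subspace_coord_space])
    ultimately show "?p z + A (?q z) = 0 \<and> ?q z \<in> resonance_space \<Lambda> I"
      using R support_independent by blast
  qed
  also have "\<dots> \<longleftrightarrow> weight_sum \<Lambda> x = weight_sum \<Lambda> y" by (simp add: z_def weight_sum_diff)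
  finally show ?thesis .
qed

lemma range_reconstruction:
  assumes A: "linear_extension \<Lambda> I A"
  shows "range (reconstruction \<Lambda> I A) = carrier (reconstructed_space \<Lambda> I)"
proof -
  have Amem: "A v \<in> carrier (coord_space I)" if "v \<in> carrier (coord_space (- I))" for v
    using A that by (auto simp: linear_extension_def)
  have carrier: "carrier (reconstructed_space \<Lambda> I) =
      carrier (coord_space I) \<times> residual_projection \<Lambda> I ` carrier (coord_space (- I))"
    by (auto simp: reconstructed_space_def direct_sum_def residual_space_def quotient_space_def
        A_RCOSETS_def' residual_projection_def)
  show ?thesis
    unfolding carrier
  proof (intro subset_antisym subsetI)
    fix x assume "x \<in> range (reconstruction \<Lambda> I A)"
    then show "x \<in> carrier (coord_space I) \<times> residual_projection \<Lambda> I ` carrier (coord_space (- I))"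
      using Amem by (auto simp: reconstruction_def vec.subspace_add[OF subspace_coord_space])
  next
    fix x assume "x \<in> carrier (coord_space I) \<times> residual_projection \<Lambda> I ` carrier (coord_space (- I))"
    then obtain c v where x: "x = (c, residual_projection \<Lambda> I v)" "c \<in> carrier (coord_space I)"
      "v \<in> carrier (coord_space (- I))" by blast
    \<comment> \<open>The preimage is \<open>(c - A v) + v\<close>: the reconstruction adds
      \<open>A v\<close> back to the support component.\<close>
    have cA: "c - A v \<in> carrier (coord_space I)"
      using x Amem by (intro vec.subspace_diff[OF subspace_coord_space])
    then have "restrict_coords I ((c - A v) + v) = c - A v"
      and "restrict_coords (- I) ((c - A v) + v) = v"
      using x restrict_coords_complement[of v "- I"]
      by (simp_all add: vec.linear_add[OF linear_restrict_coords] restrict_coords_id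
          restrict_coords_complement)
    then have "reconstruction \<Lambda> I A ((c - A v) + v) = x"
      using x by (simp add: reconstruction_def)
    then show "x \<in> range (reconstruction \<Lambda> I A)" by (metis rangeI)
  qed
qed

lemma reconstruction_linear:
  assumes A: "linear_extension \<Lambda> I A"
  shows "reconstruction \<Lambda> I A (x + y) =
      reconstruction \<Lambda> I A x \<oplus>\<^bsub>reconstructed_space \<Lambda> I\<^esub> reconstruction \<Lambda> I A y"
    and "reconstruction \<Lambda> I A (c *s x) = c \<odot>\<^bsub>reconstructed_space \<Lambda> I\<^esub> reconstruction \<Lambda> I A x"
proof -
  have "A (v + w) = A v + A w"
    if "v \<in> carrier (coord_space (- I))" "w \<in> carrier (coord_space (- I))" for v w
    using A that by (auto simp: linear_extension_def clinear_on_def)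
  moreover have "A (c *s v) = c *s A v" if "v \<in> carrier (coord_space (- I))" for v c
    using A that by (auto simp: linear_extension_def clinear_on_def)
  ultimately show "reconstruction \<Lambda> I A (x + y) =
      reconstruction \<Lambda> I A x \<oplus>\<^bsub>reconstructed_space \<Lambda> I\<^esub> reconstruction \<Lambda> I A y"
    and "reconstruction \<Lambda> I A (c *s x) = c \<odot>\<^bsub>reconstructed_space \<Lambda> I\<^esub> reconstruction \<Lambda> I A x"
    by (simp_all add: reconstruction_def reconstructed_space_def direct_sum_def
        residual_projection_add residual_projection_scale vec.linear_add[OF linear_restrict_coords]
        vec.linear_scale[OF linear_restrict_coords] vec.scale_right_distrib)
qed

text \<open>\<open>reconstruction\<close> and \<open>weight_sum\<close> are linear maps onto their
  spaces with the same fibres.\<close>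

lemma reconstructed_equivalent_weights:
  assumes A: "linear_extension \<Lambda> I A"
  shows "linearly_equivalent (reconstructed_space \<Lambda> I) (reconstructed_weights \<Lambda> I A)
    (coord_space UNIV) \<Lambda>"
proof -
  have "linearly_equivalent (reconstructed_space \<Lambda> I) (\<lambda>j. reconstruction \<Lambda> I A (axis j 1))
      (coord_space UNIV) (\<lambda>j. weight_sum \<Lambda> (axis j 1))"
    by (rule linearly_equivalent_if_same_kernel)
      (simp_all add: range_reconstruction[OF A] reconstruction_linear[OF A]
        reconstruction_kernel[OF A] range_weight_sum[OF spanning] weight_sum_add weight_sum_scale)
  then show ?thesis by (simp add: reconstruction_axis[OF A])
qed

lemma reconstructed_independent_of_extension:
  assumes A: "linear_extension \<Lambda> I A" and A': "linear_extension \<Lambda> I A'"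
  shows "linearly_equivalent (reconstructed_space \<Lambda> I) (reconstructed_weights \<Lambda> I A)
    (reconstructed_space \<Lambda> I) (reconstructed_weights \<Lambda> I A')"
proof -
  have "linearly_equivalent (reconstructed_space \<Lambda> I) (\<lambda>j. reconstruction \<Lambda> I A (axis j 1))
      (reconstructed_space \<Lambda> I) (\<lambda>j. reconstruction \<Lambda> I A' (axis j 1))"
    by (rule linearly_equivalent_if_same_kernel)
      (simp_all add: range_reconstruction A A' reconstruction_linear reconstruction_kernel)
  then show ?thesis by (simp add: reconstruction_axis A A')
qed

end

subsection \<open>Germs along monomial curves\<close>

text \<open>Every nonconstant term contains some factor \<open>y i\<close>, so shrinking the
  polydisc by \<delta> gains a factor \<delta> in it. The absolutely convergent series at radius
  \<open>\<rho>\<close> serves as majorant.\<close>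

lemma analytic_at_origin_bound:
  assumes A: "finite A" and F: "analytic_at_origin A F"
  shows "\<exists>\<rho>>0. \<exists>C\<ge>0. \<forall>y \<delta>. 0 < \<delta> \<longrightarrow> \<delta> \<le> 1 \<longrightarrow> (\<forall>i\<in>A. norm (y i) \<le> \<delta> * \<rho>) \<longrightarrow>
    norm (F y - F (\<lambda>_. 0)) \<le> \<delta> * C"
proof -
  let ?N = "{\<nu> :: 'a \<Rightarrow> nat. \<forall>i. i \<notin> A \<longrightarrow> \<nu> i = 0}"
  obtain a r where r: "r > 0" and sum: "\<And>y. (\<forall>i\<in>A. norm (y i) < r) \<Longrightarrow>
      ((\<lambda>\<nu>. a \<nu> * (\<Prod>i\<in>A. y i ^ \<nu> i)) has_sum F y) ?N"
    using F unfolding analytic_at_origin_def by blast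
  \<comment> \<open>Convergence is known only for radii strictly below \<open>r\<close>.\<close>
  define \<rho> where "\<rho> = r / 2"
  have \<rho>: "\<rho> > 0" "\<rho> < r" using r by (auto simp: \<rho>_def)
  define b where "b \<nu> = norm (a \<nu>) * \<rho> ^ (\<Sum>i\<in>A. \<nu> i)" for \<nu> :: "'a \<Rightarrow> nat"
  have "(\<lambda>\<nu>. a \<nu> * (\<Prod>i\<in>A. of_real \<rho> ^ \<nu> i)) summable_on ?N"
    using sum[of "\<lambda>_. of_real \<rho>"] \<rho> unfolding summable_on_def by auto
  then have "(\<lambda>\<nu>. norm (a \<nu> * (\<Prod>i\<in>A. of_real \<rho> ^ \<nu> i))) summable_on ?N"
    by (simp only: summable_on_iff_abs_summable_on_complex)
  moreover have "norm (a \<nu> * (\<Prod>i\<in>A. of_real \<rho> ^ \<nu> i)) = b \<nu>" for \<nu>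
    using \<rho> by (simp add: b_def norm_mult norm_power power_sum[symmetric])
  ultimately have "b summable_on ?N" by simp
  then obtain C where C: "(b has_sum C) ?N" unfolding summable_on_def by blast
  have "norm (F y - F (\<lambda>_. 0)) \<le> \<delta> * C"
    if \<delta>: "0 < \<delta>" "\<delta> \<le> 1" and y: "\<forall>i\<in>A. norm (y i) \<le> \<delta> * \<rho>" for y :: "'a \<Rightarrow> complex" and \<delta> :: real
  proof (rule norm_infsum_le)
    have "\<delta> * \<rho> \<le> \<rho>" using \<delta> \<rho> by (simp add: mult_left_le_one_le)
    then have "\<forall>i\<in>A. norm (y i) < r" using y \<rho> by (meson le_less_trans)
    then have 1: "((\<lambda>\<nu>. a \<nu> * (\<Prod>i\<in>A. y i ^ \<nu> i)) has_sum F y) ?N" by (rule sum)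
    \<comment> \<open>As 0 ^ 0 = 1, the series at the origin keeps exactly the constant term, which
      cancels in the difference.\<close>
    have 2: "((\<lambda>\<nu>. a \<nu> * (\<Prod>i\<in>A. 0 ^ \<nu> i)) has_sum F (\<lambda>_. 0)) ?N"
      using sum[of "\<lambda>_. 0"] r by simp
    from has_sum_add[OF 1 has_sum_uminusI[OF 2]]
    show "((\<lambda>\<nu>. a \<nu> * (\<Prod>i\<in>A. y i ^ \<nu> i) - a \<nu> * (\<Prod>i\<in>A. 0 ^ \<nu> i)) has_sum
        (F y - F (\<lambda>_. 0))) ?N"
      by simp
    show "((\<lambda>\<nu>. \<delta> * b \<nu>) has_sum \<delta> * C) ?N" using C by (rule has_sum_cmult_right)
    fix \<nu> :: "'a \<Rightarrow> nat"
    show "norm (a \<nu> * (\<Prod>i\<in>A. y i ^ \<nu> i) - a \<nu> * (\<Prod>i\<in>A. 0 ^ \<nu> i)) \<le> \<delta> * b \<nu>"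
    proof (cases "\<forall>i\<in>A. \<nu> i = 0")
      case True
      then show ?thesis using \<delta> \<rho> by (simp add: b_def)
    next
      case False
      then obtain k where k: "k \<in> A" "\<nu> k \<noteq> 0" by blast
      then have zero: "(\<Prod>i\<in>A. (0::complex) ^ \<nu> i) = 0" using A by (intro prod_zero) auto
      have "1 \<le> \<nu> k" using k by simp
      also have "\<dots> \<le> (\<Sum>i\<in>A. \<nu> i)" using k A by (intro member_le_sum) auto
      finally have pow: "\<delta> ^ (\<Sum>i\<in>A. \<nu> i) \<le> \<delta> ^ 1" using \<delta> by (intro power_decreasing) auto
      have "norm (\<Prod>i\<in>A. y i ^ \<nu> i) \<le> (\<Prod>i\<in>A. (\<delta> * \<rho>) ^ \<nu> i)"
        unfolding prod_norm[symmetric] norm_power using y by (intro prod_mono power_mono conjI) auto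
      also have "\<dots> = \<delta> ^ (\<Sum>i\<in>A. \<nu> i) * \<rho> ^ (\<Sum>i\<in>A. \<nu> i)"
        by (simp add: power_sum power_mult_distrib prod.distrib)
      also have "\<dots> \<le> \<delta> * \<rho> ^ (\<Sum>i\<in>A. \<nu> i)"
        using pow \<rho> by (intro mult_right_mono) auto
      finally have "norm (\<Prod>i\<in>A. y i ^ \<nu> i) \<le> \<delta> * \<rho> ^ (\<Sum>i\<in>A. \<nu> i)" .
      then have "norm (a \<nu>) * norm (\<Prod>i\<in>A. y i ^ \<nu> i) \<le> norm (a \<nu>) * (\<delta> * \<rho> ^ (\<Sum>i\<in>A. \<nu> i))"
        by (rule mult_left_mono) simp
      then show ?thesis using zero
        by (simp add: b_def norm_mult mult_ac)
    qed
  qed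
  moreover have "C \<ge> 0"
    using has_sum_nonneg[OF C] \<rho> by (simp add: b_def)
  ultimately show ?thesis using \<rho> by blast
qed

lemma analytic_at_origin_tendsto:
  assumes A: "finite A" and F: "analytic_at_origin A F"
    and y: "\<And>i. i \<in> A \<Longrightarrow> ((\<lambda>x. y x i) \<longlongrightarrow> 0) G"
  shows "((\<lambda>x. F (y x)) \<longlongrightarrow> F (\<lambda>_. 0)) G"
proof (rule tendstoI)
  fix e :: real assume e: "e > 0"
  obtain \<rho> C where \<rho>: "\<rho> > 0" and C: "C \<ge> 0" and bound: "\<And>y \<delta>. 0 < \<delta> \<Longrightarrow> \<delta> \<le> 1 \<Longrightarrow>
      (\<forall>i\<in>A. norm (y i) \<le> \<delta> * \<rho>) \<Longrightarrow> norm (F y - F (\<lambda>_. 0)) \<le> \<delta> * C"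
    using analytic_at_origin_bound[OF A F] by blast
  \<comment> \<open>Dividing by \<open>C + 1\<close> makes \<open>\<delta> * C\<close> strictly less
    than \<open>e\<close>, also when \<open>C\<close> is 0.\<close>
  define \<delta> where "\<delta> = min 1 (e / (C + 1))"
  have \<delta>: "\<delta> > 0" "\<delta> \<le> 1" using e C by (auto simp: \<delta>_def)
  have "\<delta> * C < \<delta> * (C + 1)" using \<delta> by simp
  also have "\<dots> \<le> e / (C + 1) * (C + 1)" using C by (intro mult_right_mono) (auto simp: \<delta>_def)
  also have "\<dots> = e" using C by simp
  finally have small: "\<delta> * C < e" .
  have "\<forall>\<^sub>F x in G. \<forall>i\<in>A. norm (y x i) < \<delta> * \<rho>"
    using A \<delta> \<rho> by (intro eventually_ball_finite ballI order_tendstoD(2)[OF tendsto_norm_zero[OF y]]) auto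
  then show "\<forall>\<^sub>F x in G. dist (F (y x)) (F (\<lambda>_. 0)) < e"
  proof eventually_elim
    case (elim x)
    then have "norm (F (y x) - F (\<lambda>_. 0)) \<le> \<delta> * C" using \<delta> by (intro bound) auto
    then show ?case using small by (simp add: dist_norm)
  qed
qed

section \<open>Leading exponents and separating weights\<close>

text \<open>The exponents are distinct, so the lowest one with nonzero coefficient governs the sum
  as e tends to 0. The right side has exact order \<open>M\<close> because \<open>V\<close> has a
  nonzero limit.\<close>

lemma leading_exponent:
  fixes a :: "'b \<Rightarrow> complex" and V :: "real \<Rightarrow> complex"
  assumes K: "finite K" "inj_on d K" and V: "(V \<longlongrightarrow> U) (at_right 0)" "U \<noteq> 0"
    and eq: "\<forall>\<^sub>F e in at_right 0. (\<Sum>\<beta>\<in>K. a \<beta> * of_real e ^ d \<beta>) = of_real e ^ M * V e"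
  shows "\<exists>\<beta>\<in>K. a \<beta> \<noteq> 0 \<and> d \<beta> = M"
proof -
  define K' where "K' = {\<beta> \<in> K. a \<beta> \<noteq> 0}"
  have K': "finite K'" using K by (simp add: K'_def)
  have pos: "\<forall>\<^sub>F e in at_right (0::real). e > 0" by (simp add: eventually_at_filter)
  have eq': "\<forall>\<^sub>F e in at_right 0. (\<Sum>\<beta>\<in>K'. a \<beta> * of_real e ^ d \<beta>) = of_real e ^ M * V e"
    using eq
  proof eventually_elim
    case (elim e)
    have "(\<Sum>\<beta>\<in>K. a \<beta> * of_real e ^ d \<beta>) = (\<Sum>\<beta>\<in>K'. a \<beta> * of_real e ^ d \<beta>)"
      using K by (intro sum.mono_neutral_right) (auto simp: K'_def)
    then show ?case using elim by simp
  qed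
  have limit: "((\<lambda>e. \<Sum>\<beta>\<in>K'. a \<beta> * of_real e ^ (d \<beta> - l)) \<longlongrightarrow> (\<Sum>\<beta>\<in>K'. a \<beta> * 0 ^ (d \<beta> - l))) (at_right 0)" for l
  proof -
    have "((\<lambda>e. \<Sum>\<beta>\<in>K'. a \<beta> * of_real e ^ (d \<beta> - l)) \<longlongrightarrow>
        (\<Sum>\<beta>\<in>K'. a \<beta> * of_real 0 ^ (d \<beta> - l))) (at_right 0)"
      by (intro tendsto_intros)
    then show ?thesis by simp
  qed
  show ?thesis
  proof (rule ccontr)
    assume neg: "\<not> ?thesis"
    \<comment> \<open>If all exponents exceed \<open>M\<close>, division by e^M forces
      \<open>V\<close> to tend to 0. This covers an empty \<open>K'\<close> as well.\<close>
    have no_high: False if high: "\<And>\<beta>. \<beta> \<in> K' \<Longrightarrow> M < d \<beta>"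
    proof -
      have "\<forall>\<^sub>F e in at_right 0. (\<Sum>\<beta>\<in>K'. a \<beta> * of_real e ^ (d \<beta> - M)) = V e"
        using eq' pos
      proof eventually_elim
        case (elim e)
        have "(\<Sum>\<beta>\<in>K'. a \<beta> * of_real e ^ d \<beta>) =
            of_real e ^ M * (\<Sum>\<beta>\<in>K'. a \<beta> * of_real e ^ (d \<beta> - M))"
          unfolding sum_distrib_left
        proof (rule sum.cong[OF refl])
          fix \<beta> assume "\<beta> \<in> K'"
          then have "d \<beta> = M + (d \<beta> - M)" using high by (simp add: less_imp_le)
          then show "a \<beta> * of_real e ^ d \<beta> = of_real e ^ M * (a \<beta> * of_real e ^ (d \<beta> - M))"
            by (metis mult.left_commute power_add)
        qed
        then show ?case using elim by simp
      qed
      then have "(V \<longlongrightarrow> (\<Sum>\<beta>\<in>K'. a \<beta> * 0 ^ (d \<beta> - M))) (at_right 0)"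
        using limit[of M] by (rule Lim_transform_eventually[rotated])
      moreover have "(\<Sum>\<beta>\<in>K'. a \<beta> * 0 ^ (d \<beta> - M)) = 0"
        using high by (intro sum.neutral) auto
      ultimately have "(V \<longlongrightarrow> 0) (at_right 0)" by simp
      from tendsto_unique[OF trivial_limit_at_right_real V(1) this] show False using V(2) by simp
    qed
    then obtain \<beta>1 where "\<beta>1 \<in> K'" "d \<beta>1 \<le> M" by (meson not_le)
    define l where "l = Min (d ` K')"
    have "K' \<noteq> {}" using \<open>\<beta>1 \<in> K'\<close> by auto
    then have "l \<in> d ` K'" unfolding l_def using K' by (intro Min_in) auto
    then obtain \<beta>0 where \<beta>0: "\<beta>0 \<in> K'" "d \<beta>0 = l" by auto
    have min: "l \<le> d \<beta>" if "\<beta> \<in> K'" for \<beta> unfolding l_def using K' that by (intro Min_le) auto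
    have "l \<noteq> M" using neg \<beta>0 by (auto simp: K'_def)
    then have lM: "l < M" using min[OF \<open>\<beta>1 \<in> K'\<close>] \<open>d \<beta>1 \<le> M\<close> by simp
    \<comment> \<open>Division by the lowest power leaves a positive power of e on the right, so
      both sides tend to 0, whereas the left side tends to the leading coefficient.\<close>
    have "\<forall>\<^sub>F e in at_right 0. (\<Sum>\<beta>\<in>K'. a \<beta> * of_real e ^ (d \<beta> - l)) = of_real e ^ (M - l) * V e"
      using eq' pos
    proof eventually_elim
      case (elim e)
      have "(\<Sum>\<beta>\<in>K'. a \<beta> * of_real e ^ d \<beta>) =
          of_real e ^ l * (\<Sum>\<beta>\<in>K'. a \<beta> * of_real e ^ (d \<beta> - l))"
        unfolding sum_distrib_left
      proof (rule sum.cong[OF refl])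
        fix \<beta> assume "\<beta> \<in> K'"
        then have "d \<beta> = l + (d \<beta> - l)" using min by simp
        then show "a \<beta> * of_real e ^ d \<beta> = of_real e ^ l * (a \<beta> * of_real e ^ (d \<beta> - l))"
          by (metis mult.left_commute power_add)
      qed
      moreover have "complex_of_real e ^ M = of_real e ^ l * of_real e ^ (M - l)"
        using lM by (simp add: power_add[symmetric])
      ultimately show ?case using elim by simp
    qed
    then have "((\<lambda>e. of_real e ^ (M - l) * V e) \<longlongrightarrow> (\<Sum>\<beta>\<in>K'. a \<beta> * 0 ^ (d \<beta> - l))) (at_right 0)"
      using limit[of l] by (rule Lim_transform_eventually[rotated])
    moreover have "((\<lambda>e. complex_of_real e ^ (M - l) * V e) \<longlongrightarrow> of_real 0 ^ (M - l) * U) (at_right 0)"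
      using V by (intro tendsto_intros)
    ultimately have "(\<Sum>\<beta>\<in>K'. a \<beta> * 0 ^ (d \<beta> - l)) = of_real 0 ^ (M - l) * U"
      by (rule tendsto_unique[OF trivial_limit_at_right_real])
    also have "\<dots> = 0" using lM by simp
    finally have zero: "(\<Sum>\<beta>\<in>K'. a \<beta> * 0 ^ (d \<beta> - l)) = 0" .
    have "(\<Sum>\<beta>\<in>K'. a \<beta> * 0 ^ (d \<beta> - l)) = a \<beta>0 + (\<Sum>\<beta>\<in>K' - {\<beta>0}. a \<beta> * 0 ^ (d \<beta> - l))"
      using \<beta>0 by (simp add: sum.remove[OF K' \<beta>0(1)])
    also have "(\<Sum>\<beta>\<in>K' - {\<beta>0}. a \<beta> * 0 ^ (d \<beta> - l)) = 0"
    proof (intro sum.neutral ballI)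
      fix \<beta> assume "\<beta> \<in> K' - {\<beta>0}"
      then have "d \<beta> \<noteq> d \<beta>0" using K(2) \<beta>0 by (auto simp: K'_def inj_on_def)
      then have "d \<beta> - l \<noteq> 0" using min[of \<beta>] \<open>\<beta> \<in> K' - {\<beta>0}\<close> \<beta>0 by auto
      then show "a \<beta> * 0 ^ (d \<beta> - l) = 0" by simp
    qed
    finally show False using zero \<beta>0 by (simp add: K'_def)
  qed
qed

text \<open>The weights are powers of one integer t with distinct exponents \<open>idx j\<close>.
  Two exponent vectors then collide only if t is a root of a nonzero integer polynomial formed from
  their difference, and finitely many pairs exclude finitely many t.\<close>

lemma ex_separating_weights:
  fixes K :: "(nat ^ 'n::finite) set"
  assumes "finite K"
  shows "\<exists>m :: 'n \<Rightarrow> nat. (\<forall>j. 0 < m j) \<and> inj_on (\<lambda>\<beta>. \<Sum>j\<in>UNIV. \<beta> $ j * m j) K"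
proof -
  obtain idx :: "'n \<Rightarrow> nat" where idx: "inj idx"
    using finite_imp_inj_to_nat_seg[of "UNIV :: 'n set"] by auto
  define P where "P \<beta> \<gamma> = (\<Sum>j\<in>UNIV. monom (int (\<beta> $ j) - int (\<gamma> $ j)) (idx j))"
    for \<beta> \<gamma> :: "nat ^ 'n"
  define Z where "Z = (\<Union>\<beta>\<in>K. \<Union>\<gamma>\<in>K - {\<beta>}. {x. poly (P \<beta> \<gamma>) x = 0})"
  have coeff: "coeff (P \<beta> \<gamma>) (idx i) = int (\<beta> $ i) - int (\<gamma> $ i)" for \<beta> \<gamma> i
  proof -
    have "coeff (P \<beta> \<gamma>) (idx i) =
        (\<Sum>j\<in>UNIV. if j = i then int (\<beta> $ i) - int (\<gamma> $ i) else 0)"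
      unfolding P_def coeff_sum using idx by (intro sum.cong) (auto simp: inj_eq)
    then show ?thesis by simp
  qed
  have "P \<beta> \<gamma> \<noteq> 0" if "\<beta> \<noteq> \<gamma>" for \<beta> \<gamma>
  proof
    assume "P \<beta> \<gamma> = 0"
    then have "\<beta> $ i = \<gamma> $ i" for i using coeff[of \<beta> \<gamma> i] by simp
    then show False using that by (simp add: vec_eq_iff)
  qed
  then have "finite Z"
    unfolding Z_def using assms by (intro finite_UN_I poly_roots_finite) auto
  \<comment> \<open>Excluding 0 makes the weights positive, so that the curve built from them tends
    to the origin. Negative roots, which \<open>nat\<close> sends to 0, are harmless.\<close>
  then have "finite (insert 0 (nat ` Z))" by simp
  from ex_new_if_finite[OF infinite_UNIV_nat this]
  obtain t where t: "t \<notin> insert 0 (nat ` Z)" ..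
  have "inj_on (\<lambda>\<beta>. \<Sum>j\<in>UNIV. \<beta> $ j * t ^ idx j) K"
  proof (rule inj_onI, rule ccontr)
    fix \<beta> \<gamma> assume *: "\<beta> \<in> K" "\<gamma> \<in> K" "\<beta> \<noteq> \<gamma>"
      and "(\<Sum>j\<in>UNIV. \<beta> $ j * t ^ idx j) = (\<Sum>j\<in>UNIV. \<gamma> $ j * t ^ idx j)"
    then have "int (\<Sum>j\<in>UNIV. \<beta> $ j * t ^ idx j) = int (\<Sum>j\<in>UNIV. \<gamma> $ j * t ^ idx j)" by simp
    then have "poly (P \<beta> \<gamma>) (int t) = 0"
      by (simp add: P_def poly_sum poly_monom left_diff_distrib sum_subtractf)
    then have "int t \<in> Z" using * by (auto simp: Z_def)
    then have "t \<in> nat ` Z" by (metis image_eqI nat_int)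
    then show False using t by simp
  qed
  moreover have "\<forall>j. 0 < t ^ idx j" using t by simp
  ultimately show ?thesis by (intro exI[of _ "\<lambda>j. t ^ idx j"]) simp
qed

subsection \<open>Points of the quotient\<close>

definition residual_monomial :: "'n set \<Rightarrow> complex ^ 'n::finite \<Rightarrow> nat ^ 'n \<Rightarrow> complex" where
  "residual_monomial I w \<alpha> = (\<Prod>j\<in>-I. w $ j ^ (\<alpha> $ j))"

text \<open>Unlike \<open>quotient_map\<close>, the evaluation is not restricted to the resonance
  algebra, so it respects sums and products without membership conditions.\<close>

definition residual_eval :: "'n set \<Rightarrow> complex ^ 'n::finite \<Rightarrow> ((nat ^ 'n) \<Rightarrow>\<^sub>0 complex) \<Rightarrow> complex" where
  "residual_eval I w p =
     (\<Sum>\<alpha>\<in>Poly_Mapping.keys p. Poly_Mapping.lookup p \<alpha> * residual_monomial I w \<alpha>)"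

lemma quotient_map_eq:
  "quotient_map \<Lambda> I w = restrict (residual_eval I w) (carrier (resonance_algebra \<Lambda> I))"
  by (rule ext) (simp add: quotient_map_def residual_eval_def residual_monomial_def restrict_def)

lemma residual_monomial_add:
  "residual_monomial I w (\<alpha> + \<beta>) = residual_monomial I w \<alpha> * residual_monomial I w \<beta>"
  by (simp add: residual_monomial_def power_add prod.distrib)

lemma residual_eval_superset:
  assumes "finite B" "Poly_Mapping.keys p \<subseteq> B"
  shows "residual_eval I w p = (\<Sum>\<alpha>\<in>B. Poly_Mapping.lookup p \<alpha> * residual_monomial I w \<alpha>)"
  unfolding residual_eval_def using assms
  by (intro sum.mono_neutral_left) (auto simp: in_keys_iff)

lemma residual_eval_add: "residual_eval I w (p + q) = residual_eval I w p + residual_eval I w q"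
proof -
  let ?B = "Poly_Mapping.keys p \<union> Poly_Mapping.keys q"
  have "residual_eval I w (p + q) =
      (\<Sum>\<alpha>\<in>?B. Poly_Mapping.lookup (p + q) \<alpha> * residual_monomial I w \<alpha>)"
    using keys_add[of p q] by (intro residual_eval_superset) auto
  then show ?thesis
    by (simp add: residual_eval_superset[of ?B] lookup_add distrib_right sum.distrib)
qed

lemma residual_eval_0 [simp]: "residual_eval I w 0 = 0"
  by (simp add: residual_eval_def)

lemma residual_eval_sum: "residual_eval I w (sum f B) = (\<Sum>x\<in>B. residual_eval I w (f x))"
  by (induction B rule: infinite_finite_induct) (simp_all add: residual_eval_add)

lemma residual_eval_single [simp]:
  "residual_eval I w (Poly_Mapping.single \<alpha> c) = c * residual_monomial I w \<alpha>"
  using residual_eval_superset[of "{\<alpha>}" "Poly_Mapping.single \<alpha> c" I w] by simp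

lemma residual_eval_mult: "residual_eval I w (p * q) = residual_eval I w p * residual_eval I w q"
proof -
  have "p * q = (\<Sum>\<alpha>\<in>Poly_Mapping.keys p. \<Sum>\<beta>\<in>Poly_Mapping.keys q.
      Poly_Mapping.single (\<alpha> + \<beta>) (Poly_Mapping.lookup p \<alpha> * Poly_Mapping.lookup q \<beta>))"
    by (subst sum_singles[of p, symmetric], subst sum_singles[of q, symmetric])
      (simp add: sum_product mult_single)
  then have "residual_eval I w (p * q) = (\<Sum>\<alpha>\<in>Poly_Mapping.keys p. \<Sum>\<beta>\<in>Poly_Mapping.keys q.
      (Poly_Mapping.lookup p \<alpha> * residual_monomial I w \<alpha>) *
      (Poly_Mapping.lookup q \<beta> * residual_monomial I w \<beta>))"
    by (simp add: residual_eval_sum residual_monomial_add mult_ac)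
  then show ?thesis by (simp add: residual_eval_def sum_product)
qed

lemma quotient_map_in_spec: "quotient_map \<Lambda> I w \<in> spec_points (resonance_algebra \<Lambda> I)"
proof -
  have S: "submonoid_exponents (resonances \<Lambda> I)" by (rule submonoid_resonances)
  have one: "Poly_Mapping.keys (1 :: (nat ^ 'a) \<Rightarrow>\<^sub>0 complex) \<subseteq> resonances \<Lambda> I"
    and single: "Poly_Mapping.keys (Poly_Mapping.single 0 c :: (nat ^ 'a) \<Rightarrow>\<^sub>0 complex) \<subseteq> resonances \<Lambda> I" for c
    using S by (auto simp: submonoid_exponents_def)
  have "residual_eval I w 1 = 1"
    using residual_eval_single[of I w 0 1] by (simp add: residual_monomial_def)
  then show ?thesis
    using one single unfolding spec_points_def quotient_map_eq ring_hom_def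
    by (auto simp: keys_mult_subset[OF S] keys_add_subset residual_eval_mult residual_eval_add
        complex_ring_def residual_monomial_def)
qed

lemma continuous_quotient_map: "continuous_on UNIV (quotient_map \<Lambda> I)"
proof (rule continuous_on_coordinatewise_then_product)
  fix p
  show "continuous_on UNIV (\<lambda>w. quotient_map \<Lambda> I w p)"
    by (cases "p \<in> carrier (resonance_algebra \<Lambda> I)")
      (auto simp: quotient_map_eq residual_eval_def residual_monomial_def intro!: continuous_intros)
qed

text \<open>This carries statements about germs at the vertex of the quotient back to germs at the
  origin of \<complex>^J.\<close>

lemma filterlim_quotient_map:
  "filterlim (quotient_map \<Lambda> I) (near_in (vertex \<Lambda> I) (spec_points (resonance_algebra \<Lambda> I)))
     (near_in 0 (carrier (coord_space (- I))))"
proof -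
  have "(quotient_map \<Lambda> I \<longlongrightarrow> vertex \<Lambda> I) (nhds 0)"
    using continuous_quotient_map[of \<Lambda> I] 
    by (simp add: continuous_on_eq_continuous_at isCont_def tendsto_at_iff_tendsto_nhds)
  then have "(quotient_map \<Lambda> I \<longlongrightarrow> vertex \<Lambda> I) (near_in 0 (carrier (coord_space (- I))))"
    by (rule tendsto_mono[rotated]) simp
  then show ?thesis
    by (simp add: filterlim_inf filterlim_principal quotient_map_in_spec)
qed

section \<open>Pullbacks of monomials under a labelled isomorphism\<close>

text \<open>The conclusion puts \<alpha> among the resonances of \<Lambda> and provides a monomial
  of \<open>p\<close> at which the two connections can be compared. It follows by matching exponents
  of e along a monomial curve.\<close>

lemma lookup_pullback_nonzero:
  fixes \<Lambda> :: "'n::finite \<Rightarrow> complex ^ 'k" and \<Lambda>' :: "'n \<Rightarrow> complex ^ 'l"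
  assumes iso: "labelled_quotient_iso \<Lambda> \<Lambda>' I \<phi> \<psi>"
    and \<alpha>: "\<alpha> \<in> resonances \<Lambda>' I" and p: "p \<in> carrier (resonance_algebra \<Lambda> I)"
    and pullback: "\<forall>\<^sub>F x in near_in (vertex \<Lambda> I) (spec_points (resonance_algebra \<Lambda> I)).
      x p = \<psi> x (Poly_Mapping.single \<alpha> 1)"
  shows "Poly_Mapping.lookup p \<alpha> \<noteq> 0"
proof -
  let ?G = "near_in 0 (carrier (coord_space (- I)))"
  \<comment> \<open>It is not yet known that \<alpha> occurs in \<open>p\<close>; the weights must
    separate it from the exponents that do.\<close>
  let ?K = "insert \<alpha> (Poly_Mapping.keys p)"
  obtain u where u0: "\<And>j. j \<in> - I \<Longrightarrow> u j 0 \<noteq> 0"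
    and u: "\<And>j. j \<in> - I \<Longrightarrow> analytic_at_origin (- I) (\<lambda>y. u j (\<chi> l. if l \<in> I then 0 else y l))"
    and \<phi>: "\<forall>\<^sub>F w in ?G. \<phi> w = (\<chi> j. w $ j * u j w)"
    using iso unfolding labelled_quotient_iso_def label_preserving_germ_def by blast
  have \<psi>: "\<forall>\<^sub>F w in ?G. \<psi> (quotient_map \<Lambda> I w) = quotient_map \<Lambda>' I (\<phi> w)"
    using iso unfolding labelled_quotient_iso_def by blast
  obtain m :: "'n \<Rightarrow> nat" where m: "\<And>j. 0 < m j" and inj: "inj_on (\<lambda>\<beta>. \<Sum>j\<in>UNIV. \<beta> $ j * m j) ?K"
    using ex_separating_weights[of ?K] by auto
  define d where "d \<beta> = (\<Sum>j\<in>UNIV. \<beta> $ j * m j)" for \<beta> :: "nat ^ 'n"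
  define w where "w e = (\<chi> j. if j \<in> I then 0 else complex_of_real e ^ m j)" for e :: real
  have w_lim: "((\<lambda>e. w e $ j) \<longlongrightarrow> 0) (at_right 0)" for j
  proof (cases "j \<in> I")
    case False
    have "((\<lambda>e. complex_of_real e ^ m j) \<longlongrightarrow> of_real 0 ^ m j) (at_right 0)"
      by (intro tendsto_intros)
    then show ?thesis using False zero_power[OF m[of j], where 'a = complex] by (simp add: w_def)
  qed (simp add: w_def)
  have "(w \<longlongrightarrow> 0) (at_right 0)" by (rule vec_tendstoI) (simp add: w_lim)
  moreover have "w e \<in> carrier (coord_space (- I))" for e by (simp add: carrier_coord_space w_def)
  ultimately have w_filter: "filterlim w ?G (at_right 0)"
    by (simp add: filterlim_inf filterlim_principal)
  have monomial: "residual_monomial I (w e) \<beta> = of_real e ^ d \<beta>" if "\<forall>i\<in>I. \<beta> $ i = 0" for \<beta> e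
  proof -
    have "residual_monomial I (w e) \<beta> = (\<Prod>j\<in>- I. of_real e ^ (\<beta> $ j * m j))"
      unfolding residual_monomial_def by (intro prod.cong) (auto simp: w_def power_mult[symmetric] mult.commute)
    also have "\<dots> = (\<Prod>j\<in>UNIV. of_real e ^ (\<beta> $ j * m j))"
      using that by (intro prod.mono_neutral_left) auto
    finally show ?thesis by (simp add: d_def power_sum)
  qed
  \<comment> \<open>The units of the label-preserving germ, raised to the powers \<alpha>: the
    factor by which the pullback differs from the monomial on the curve. Its limit is nonzero
    because each \<open>u j 0\<close> is.\<close>
  define V where "V e = (\<Prod>j\<in>- I. u j (w e) ^ (\<alpha> $ j))" for e
  have "((\<lambda>e. u j (w e)) \<longlongrightarrow> u j 0) (at_right 0)" if "j \<in> - I" for j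
  proof -
    have "((\<lambda>e. u j (\<chi> l. if l \<in> I then 0 else w e $ l)) \<longlongrightarrow> u j (\<chi> l. if l \<in> I then 0 else 0)) (at_right 0)"
      by (rule analytic_at_origin_tendsto[OF _ u[OF that], where y = "\<lambda>e l. w e $ l"]) (simp_all add: w_lim)
    moreover have "(\<chi> l. if l \<in> I then 0 else w e $ l) = w e" for e by (simp add: w_def vec_eq_iff)
    moreover have "(\<chi> l. if l \<in> I then 0 else 0) = (0 :: complex ^ 'n)" by (simp add: vec_eq_iff)
    ultimately show ?thesis by simp
  qed
  then have V: "(V \<longlongrightarrow> (\<Prod>j\<in>- I. u j 0 ^ (\<alpha> $ j))) (at_right 0)"
    unfolding V_def by (intro tendsto_intros)
  have \<alpha>_carrier: "Poly_Mapping.single \<alpha> 1 \<in> carrier (resonance_algebra \<Lambda>' I)" using \<alpha> by simp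
  have "\<forall>\<^sub>F e in at_right 0. \<phi> (w e) = (\<chi> j. w e $ j * u j (w e))"
    using filterlim_iff[THEN iffD1, OF w_filter] \<phi> by blast
  moreover have "\<forall>\<^sub>F e in at_right 0. \<psi> (quotient_map \<Lambda> I (w e)) = quotient_map \<Lambda>' I (\<phi> (w e))"
    using filterlim_iff[THEN iffD1, OF w_filter] \<psi> by blast
  moreover have "\<forall>\<^sub>F e in at_right 0.
      quotient_map \<Lambda> I (w e) p = \<psi> (quotient_map \<Lambda> I (w e)) (Poly_Mapping.single \<alpha> 1)"
    using filterlim_iff[THEN iffD1, OF filterlim_compose[OF filterlim_quotient_map w_filter]] pullback
    by blast
  ultimately have "\<forall>\<^sub>F e in at_right 0.
      (\<Sum>\<beta>\<in>?K. Poly_Mapping.lookup p \<beta> * of_real e ^ d \<beta>) = of_real e ^ d \<alpha> * V e"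
  proof eventually_elim
    case (elim e)
    have "residual_eval I (w e) p = (\<Sum>\<beta>\<in>?K. Poly_Mapping.lookup p \<beta> * residual_monomial I (w e) \<beta>)"
      by (rule residual_eval_superset) auto
    also have "\<dots> = (\<Sum>\<beta>\<in>?K. Poly_Mapping.lookup p \<beta> * of_real e ^ d \<beta>)"
      using p \<alpha> by (intro sum.cong arg_cong2[where f = "(*)"] monomial refl) (auto simp: resonances_def)
    finally have "(\<Sum>\<beta>\<in>?K. Poly_Mapping.lookup p \<beta> * of_real e ^ d \<beta>) = quotient_map \<Lambda> I (w e) p"
      using p by (simp add: quotient_map_eq)
    also have "\<dots> = residual_monomial I (\<phi> (w e)) \<alpha>"
      using elim \<alpha>_carrier by (simp add: quotient_map_eq)
    also have "\<dots> = residual_monomial I (w e) \<alpha> * V e"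
      by (simp add: elim(1) residual_monomial_def V_def power_mult_distrib prod.distrib)
    also have "residual_monomial I (w e) \<alpha> = of_real e ^ d \<alpha>"
      using \<alpha> by (intro monomial) (simp add: resonances_def)
    finally show ?case .
  qed
  then have "\<exists>\<beta>\<in>?K. Poly_Mapping.lookup p \<beta> \<noteq> 0 \<and> d \<beta> = d \<alpha>"
    using inj u0 by (intro leading_exponent[OF _ _ V]) (auto simp: d_def)
  then obtain \<beta> where \<beta>: "\<beta> \<in> ?K" "Poly_Mapping.lookup p \<beta> \<noteq> 0" "d \<beta> = d \<alpha>" by blast
  then have "\<beta> = \<alpha>" using inj_onD[OF inj, of \<beta> \<alpha>] by (simp add: d_def)
  then show ?thesis using \<beta> by simp
qed

subsection \<open>Comparison of two configurations\<close>

lemma cring_monoid_algebra: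
  assumes S: "submonoid_exponents S"
  shows "cring (monoid_algebra S)"
proof (rule cringI)
  show "abelian_group (monoid_algebra S)"
  proof (rule abelian_groupI)
    fix x assume "x \<in> carrier (monoid_algebra S)"
    then show "\<exists>y\<in>carrier (monoid_algebra S). y \<oplus>\<^bsub>monoid_algebra S\<^esub> x = \<zero>\<^bsub>monoid_algebra S\<^esub>"
      by (intro bexI[of _ "- x"]) (simp_all add: Poly_Mapping.keys.rep_eq)
  qed (simp_all add: keys_add_subset add_ac)
  show "comm_monoid (monoid_algebra S)"
    by (rule comm_monoidI)
      (use S in \<open>simp_all add: keys_mult_subset mult_ac submonoid_exponents_def\<close>)
qed (simp add: distrib_right)

text \<open>Preimages of primes are prime, and surjectivity keeps the inclusions of a chain
  proper.\<close>

lemma krull_dim_le_if_surjective_hom: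
  assumes A: "cring A" and B: "cring B" and h: "h \<in> ring_hom A B" "h ` carrier A = carrier B"
  shows "krull_dim B \<le> krull_dim A"
  unfolding krull_dim_def
proof (rule Sup_subset_mono, safe)
  fix m P
  assume prime: "\<forall>i\<le>m. primeideal (P i) B" and sub: "\<forall>i<m. P i \<subset> P (Suc i)"
  interpret ring_hom_ring A B h
    by (rule ring_hom_ringI2) (use A B h in \<open>auto simp: cring_def\<close>)
  define Q where "Q i = {r \<in> carrier A. h r \<in> P i}" for i :: nat
  have "primeideal (Q i) A" if "i \<le> m" for i
    unfolding Q_def using prime that by (intro primeideal_vimage A) auto
  moreover have "Q i \<subset> Q (Suc i)" if i: "i < m" for i
  proof -
    obtain b where b: "b \<in> P (Suc i)" "b \<notin> P i" using sub i by blast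
    have "ideal (P (Suc i)) B" using prime i by (simp add: primeideal_def)
    then have "b \<in> carrier B"
      using b(1) additive_subgroup.a_subset[OF ideal.axioms(1)] by blast
    then obtain a where "a \<in> carrier A" "h a = b" unfolding h(2)[symmetric] by auto
    then have "a \<in> Q (Suc i)" "a \<notin> Q i" using b by (auto simp: Q_def)
    moreover have "Q i \<subseteq> Q (Suc i)" using sub i unfolding Q_def by blast
    ultimately show ?thesis by blast
  qed
  ultimately show "\<exists>m'. enat m = enat m' \<and>
      (\<exists>P. (\<forall>i\<le>m'. primeideal (P i) A) \<and> (\<forall>i<m'. P i \<subset> P (Suc i)))"
    by (intro exI[of _ m] conjI exI[of _ Q]) auto
qed

section \<open>Support coefficients as eigenvalues of the connection\<close>

lemma lookup_scale:
  "Poly_Mapping.lookup (Poly_Mapping.single 0 c * p) \<beta> = (c :: complex) * Poly_Mapping.lookup p \<beta>"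
  for p :: "(nat ^ 'n::finite) \<Rightarrow>\<^sub>0 complex"
  by (simp add: mult_map_scale_conv_mult[symmetric] Poly_Mapping.map.rep_eq when_def)

text \<open>On sections constant along the torus the exterior derivative vanishes, so the connection
  reveals the derivation \<delta>_i.\<close>

lemma log_connection_constant_section:
  assumes "i \<in> I"
  shows "log_connection \<Lambda> I (Poly_Mapping.single 0 p) i =
    Poly_Mapping.single 0 (- support_derivation \<Lambda> I i p)"
proof -
  have "Poly_Mapping.mapp (\<lambda>m f. of_int (m $ i) * f) (Poly_Mapping.single 0 p) = 0"
    by (rule poly_mapping_eqI) (simp add: lookup_mapp lookup_single when_def)
  moreover have "support_derivation \<Lambda> I i 0 = 0"
    by (rule poly_mapping_eqI) (simp add: support_derivation_def lookup_mapp)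
  ultimately show ?thesis
    using assms by (simp add: log_connection_def single_uminus)
qed

text \<open>The map \<theta> takes the eigenvector X^\<alpha> of one derivation to an eigenvector of
  the other with the same eigenvalue. The derivations are diagonal on monomials, so every X^\<beta>
  occurring in the image has that eigenvalue.\<close>

lemma support_coeffs_eq_if_connection_iso:
  assumes iso: "labelled_connection_iso \<Lambda> \<Lambda>' I \<theta>"
    and \<alpha>: "\<alpha> \<in> resonances \<Lambda>' I" and i: "i \<in> I"
    and \<beta>: "Poly_Mapping.lookup (\<theta> (Poly_Mapping.single \<alpha> 1)) \<beta> \<noteq> 0"
  shows "support_coeffs \<Lambda> I (nat_vec_to_int \<beta>) $ i = support_coeffs \<Lambda>' I (nat_vec_to_int \<alpha>) $ i"
proof -
  let ?X = "Poly_Mapping.single \<alpha> (1::complex)"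
  let ?c = "support_coeffs \<Lambda>' I (nat_vec_to_int \<alpha>) $ i"
  have hom: "\<theta> \<in> ring_hom (resonance_algebra \<Lambda>' I) (resonance_algebra \<Lambda> I)"
    and const: "\<And>c. \<theta> (Poly_Mapping.single 0 c) = Poly_Mapping.single 0 c"
    using iso by (auto simp: labelled_connection_iso_def ring_iso_def)
  have "0 \<in> resonances \<Lambda>' I" using submonoid_resonances by (auto simp: submonoid_exponents_def)
  then have scale: "\<theta> (Poly_Mapping.single 0 c * ?X) = Poly_Mapping.single 0 c * \<theta> ?X" for c
    using ring_hom_mult[OF hom, of "Poly_Mapping.single 0 c" ?X] \<alpha> by (simp add: const)
  have \<theta>0: "\<theta> 0 = 0" using const[of 0] by simp
  have "Poly_Mapping.single 0 ?X \<in> torus_sections \<Lambda>' I"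
    using \<alpha> by (simp add: torus_sections_def)
  then have "Poly_Mapping.map \<theta> (log_connection \<Lambda>' I (Poly_Mapping.single 0 ?X) i) =
      log_connection \<Lambda> I (Poly_Mapping.map \<theta> (Poly_Mapping.single 0 ?X)) i"
    using iso i unfolding labelled_connection_iso_def by blast
  then have "Poly_Mapping.single (0 :: int ^ 'a) (\<theta> (- support_derivation \<Lambda>' I i ?X)) =
      Poly_Mapping.single 0 (- support_derivation \<Lambda> I i (\<theta> ?X))"
    by (simp add: log_connection_constant_section[OF i] \<theta>0)
  then have eq: "\<theta> (- support_derivation \<Lambda>' I i ?X) = - support_derivation \<Lambda> I i (\<theta> ?X)"
    by (metis lookup_single_eq)
  have "- support_derivation \<Lambda>' I i ?X = Poly_Mapping.single 0 (- ?c) * ?X"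
    by (rule poly_mapping_eqI)
      (simp add: support_derivation_def lookup_mapp lookup_scale lookup_single when_def)
  then have "Poly_Mapping.single 0 (- ?c) * \<theta> ?X = - support_derivation \<Lambda> I i (\<theta> ?X)"
    using eq scale[of "- ?c"] by simp
  then have "Poly_Mapping.lookup (Poly_Mapping.single 0 (- ?c) * \<theta> ?X) \<beta> =
      Poly_Mapping.lookup (- support_derivation \<Lambda> I i (\<theta> ?X)) \<beta>"
    by simp
  then show ?thesis
    using \<beta> by (simp add: lookup_scale support_derivation_def lookup_mapp in_keys_iff when_def)
qed

text \<open>A relation between the \<Lambda>' has its residual part in the resonance space of
  \<Lambda>'. There both configurations have the same support coefficients, so the relation holds
  for \<Lambda> too.\<close>

lemma resonance_relations_determine_kernel:
  fixes \<Lambda> :: "'n::finite \<Rightarrow> complex ^ 'k::finite" and \<Lambda>' :: "'n \<Rightarrow> complex ^ 'l::finite"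
  assumes "full_rank_support \<Lambda> I" "full_rank_support \<Lambda>' I"
    and res: "\<And>\<alpha>. \<alpha> \<in> resonances \<Lambda>' I \<Longrightarrow> \<alpha> \<in> resonances \<Lambda> I"
    and coeffs: "\<And>\<alpha> i. \<alpha> \<in> resonances \<Lambda>' I \<Longrightarrow> i \<in> I \<Longrightarrow>
      support_coeffs \<Lambda> I (nat_vec_to_int \<alpha>) $ i = support_coeffs \<Lambda>' I (nat_vec_to_int \<alpha>) $ i"
    and v: "weight_sum \<Lambda>' v = 0"
  shows "weight_sum \<Lambda> v = 0"
proof -
  interpret F: full_rank_support \<Lambda> I by fact
  interpret F': full_rank_support \<Lambda>' I by fact
  \<comment> \<open>Vectors whose two weight sums are expressed by one common vector of support
    coefficients; being a subspace, \<open>Z\<close> contains the resonance space as soon as it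
    contains the resonances.\<close>
  define Z where "Z = {r. \<exists>c\<in>carrier (coord_space I).
      weight_sum \<Lambda> r = weight_sum \<Lambda> c \<and> weight_sum \<Lambda>' r = weight_sum \<Lambda>' c}"
  have Z: "vec.subspace Z"
  proof (rule vec.subspaceI)
    show "0 \<in> Z" unfolding Z_def using vec.subspace_0[OF subspace_coord_space] by blast
  next
    fix x y assume "x \<in> Z" "y \<in> Z"
    then obtain c d where "c \<in> carrier (coord_space I)" "d \<in> carrier (coord_space I)"
      "weight_sum \<Lambda> x = weight_sum \<Lambda> c" "weight_sum \<Lambda>' x = weight_sum \<Lambda>' c"
      "weight_sum \<Lambda> y = weight_sum \<Lambda> d" "weight_sum \<Lambda>' y = weight_sum \<Lambda>' d"
      unfolding Z_def by blast
    then show "x + y \<in> Z"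
      unfolding Z_def by (auto intro!: bexI[of _ "c + d"] vec.subspace_add[OF subspace_coord_space]
          simp: weight_sum_add)
  next
    fix a x assume "x \<in> Z"
    then obtain c where "c \<in> carrier (coord_space I)"
      "weight_sum \<Lambda> x = weight_sum \<Lambda> c" "weight_sum \<Lambda>' x = weight_sum \<Lambda>' c"
      unfolding Z_def by blast
    then show "a *s x \<in> Z"
      unfolding Z_def by (auto intro!: bexI[of _ "a *s c"] vec.subspace_scale[OF subspace_coord_space]
          simp: weight_sum_scale)
  qed
  have "int_vec_to_complex (nat_vec_to_int \<alpha>) \<in> Z" if \<alpha>: "\<alpha> \<in> resonances \<Lambda>' I" for \<alpha>
  proof -
    have \<alpha>': "nat_vec_to_int \<alpha> \<in> resonance_group \<Lambda>' I" "nat_vec_to_int \<alpha> \<in> resonance_group \<Lambda> I"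
      using \<alpha> res by (auto intro: resonance_in_resonance_group)
    have "support_coeffs \<Lambda> I (nat_vec_to_int \<alpha>) = support_coeffs \<Lambda>' I (nat_vec_to_int \<alpha>)"
      using coeffs[OF \<alpha>] F.support_coeffs(1)[OF \<alpha>'(2)] F'.support_coeffs(1)[OF \<alpha>'(1)]
      by (metis carrier_coord_space vec_eq_iff)
    then show ?thesis
      using F.support_coeffs[OF \<alpha>'(2)] F'.support_coeffs[OF \<alpha>'(1)] unfolding Z_def by auto
  qed
  then have "int_vec_to_complex ` resonance_group \<Lambda>' I \<subseteq> Z"
    unfolding resonance_group_def
    by (auto simp: int_vec_to_complex_diff intro!: vec.subspace_diff[OF Z])
  then have RZ: "resonance_space \<Lambda>' I \<subseteq> Z"
    unfolding resonance_space_def by (intro vec.span_minimal Z)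
  let ?p = "restrict_coords I v" and ?q = "restrict_coords (- I) v"
  have sum': "weight_sum \<Lambda>' ?p + weight_sum \<Lambda>' ?q = 0"
    using v by (simp add: weight_sum_add[symmetric] restrict_coords_split)
  then have "weight_sum \<Lambda>' ?q = weight_sum \<Lambda>' (- ?p)"
    by (simp add: vec.linear_neg[OF linear_weight_sum] eq_neg_iff_add_eq_0 add.commute)
  then have "?q \<in> resonance_space \<Lambda>' I"
    unfolding F'.resonance_space_eq residual_relations_def span_weights
    by (auto intro!: imageI vec.subspace_neg[OF subspace_coord_space])
  then obtain c where c: "c \<in> carrier (coord_space I)"
    "weight_sum \<Lambda> ?q = weight_sum \<Lambda> c" "weight_sum \<Lambda>' ?q = weight_sum \<Lambda>' c"
    using RZ unfolding Z_def by blast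
  \<comment> \<open>Independence of the support weights of \<Lambda>' identifies \<open>c\<close>
    with the negative of the support part of \<open>v\<close>.\<close>
  have "?p + c = 0"
    using sum' c by (intro F'.support_independent)
      (auto simp: weight_sum_add intro!: vec.subspace_add[OF subspace_coord_space])
  then have "weight_sum \<Lambda> (?p + c) = 0" by (simp add: weight_sum_0)
  then have "weight_sum \<Lambda> (?p + ?q) = 0" using c by (simp add: weight_sum_add)
  then show ?thesis by (simp add: restrict_coords_split)
qed

text \<open>The inclusion of kernels factors \<open>weight_sum \<Lambda>\<close> through
  \<open>weight_sum \<Lambda>'\<close> by a linear map \<open>T\<close>, which is onto because
  \<Lambda> spans. With the bound on dimensions \<open>T\<close> is bijective, so the kernels
  coincide.\<close>

lemma linearly_equivalent_if_kernel_subset: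
  fixes \<Lambda> :: "'n::finite \<Rightarrow> complex ^ 'k::finite" and \<Lambda>' :: "'n \<Rightarrow> complex ^ 'l::finite"
  assumes span: "vec.span (range \<Lambda>) = UNIV" "vec.span (range \<Lambda>') = UNIV"
    and card: "CARD('l) \<le> CARD('k)"
    and kernel: "\<And>v. weight_sum \<Lambda>' v = 0 \<Longrightarrow> weight_sum \<Lambda> v = 0"
  shows "linearly_equivalent (coord_space UNIV) \<Lambda> (coord_space UNIV) \<Lambda>'"
proof -
  obtain g where g: "Vector_Spaces.linear (*s) (*s) g" and Eg: "\<And>x. weight_sum \<Lambda>' (g x) = x"
    using vec.linear_surjective_right_inverse[OF linear_weight_sum[of \<Lambda>']] range_weight_sum[OF span(2)]
    by (metis comp_apply id_apply)
  define T where "T = weight_sum \<Lambda> \<circ> g"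
  have T: "T (weight_sum \<Lambda>' v) = weight_sum \<Lambda> v" for v
  proof -
    have "weight_sum \<Lambda>' (g (weight_sum \<Lambda>' v) - v) = 0" by (simp add: weight_sum_diff Eg)
    then show ?thesis using kernel by (fastforce simp: T_def weight_sum_diff)
  qed
  have "Vector_Spaces.linear (*s) (*s) T"
    unfolding T_def by (rule Vector_Spaces.linear_compose[OF g linear_weight_sum])
  moreover have surj: "surj T" using T range_weight_sum[OF span(1)] by (metis surj_def)
  moreover have "CARD('k) \<le> CARD('l)"
    using vec.dim_image_le[OF \<open>Vector_Spaces.linear (*s) (*s) T\<close>, of UNIV] surj
    by (simp add: card_cart_basis)
  ultimately have "inj T"
    using card by (intro vec.linear_surjective_imp_injective) (simp_all add: card_cart_basis)
  then have "weight_sum \<Lambda> x = weight_sum \<Lambda> y \<longleftrightarrow> weight_sum \<Lambda>' x = weight_sum \<Lambda>' y" for x y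
    by (metis T inj_eq)
  then have "linearly_equivalent (coord_space UNIV) (\<lambda>j. weight_sum \<Lambda> (axis j 1))
      (coord_space UNIV) (\<lambda>j. weight_sum \<Lambda>' (axis j 1))"
    by (intro linearly_equivalent_if_same_kernel)
      (simp_all add: range_weight_sum span weight_sum_add weight_sum_scale)
  then show ?thesis by simp
qed

text \<open>The pullback \<theta> goes from the algebra of \<Lambda>' to that of \<Lambda> and
  yields one inclusion of kernels; a comparison of dimensions replaces the other one.\<close>

lemma linearly_equivalent_if_same_labelled_data:
  fixes \<Lambda> :: "'n::finite \<Rightarrow> complex ^ 'k::finite" and \<Lambda>' :: "'n \<Rightarrow> complex ^ 'l::finite"
  assumes F: "full_rank_support \<Lambda> I" and F': "full_rank_support \<Lambda>' I"
    and same: "same_labelled_data \<Lambda> \<Lambda>' I"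
  shows "linearly_equivalent (coord_space UNIV) \<Lambda> (coord_space UNIV) \<Lambda>'"
proof -
  obtain \<phi> \<psi> \<theta> where quotient: "labelled_quotient_iso \<Lambda> \<Lambda>' I \<phi> \<psi>"
    and connection: "labelled_connection_iso \<Lambda> \<Lambda>' I \<theta>"
    and pullback: "\<And>p. p \<in> carrier (resonance_algebra \<Lambda>' I) \<Longrightarrow>
      \<forall>\<^sub>F x in near_in (vertex \<Lambda> I) (spec_points (resonance_algebra \<Lambda> I)). x (\<theta> p) = \<psi> x p"
    using same unfolding same_labelled_data_def by blast
  have \<theta>: "\<theta> \<in> ring_hom (resonance_algebra \<Lambda>' I) (resonance_algebra \<Lambda> I)"
    "bij_betw \<theta> (carrier (resonance_algebra \<Lambda>' I)) (carrier (resonance_algebra \<Lambda> I))"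
    using connection by (auto simp: labelled_connection_iso_def ring_iso_def)
  have lookup: "Poly_Mapping.lookup (\<theta> (Poly_Mapping.single \<alpha> 1)) \<alpha> \<noteq> 0"
    and mem: "\<theta> (Poly_Mapping.single \<alpha> 1) \<in> carrier (resonance_algebra \<Lambda> I)"
    if "\<alpha> \<in> resonances \<Lambda>' I" for \<alpha>
  proof -
    have X: "Poly_Mapping.single \<alpha> 1 \<in> carrier (resonance_algebra \<Lambda>' I)" using that by simp
    then show "\<theta> (Poly_Mapping.single \<alpha> 1) \<in> carrier (resonance_algebra \<Lambda> I)"
      by (rule ring_hom_closed[OF \<theta>(1)])
    then show "Poly_Mapping.lookup (\<theta> (Poly_Mapping.single \<alpha> 1)) \<alpha> \<noteq> 0"
      by (rule lookup_pullback_nonzero[OF quotient that _ pullback[OF X]])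
  qed
  have kernel: "weight_sum \<Lambda> v = 0" if "weight_sum \<Lambda>' v = 0" for v
  proof (rule resonance_relations_determine_kernel[OF F F' _ _ that])
    fix \<alpha> assume "\<alpha> \<in> resonances \<Lambda>' I"
    then show "\<alpha> \<in> resonances \<Lambda> I"
      using lookup[of \<alpha>] mem[of \<alpha>] by (auto simp: in_keys_iff)
  qed (use support_coeffs_eq_if_connection_iso[OF connection] lookup in blast)
  have span: "vec.span (range \<Lambda>) = UNIV" "vec.span (range \<Lambda>') = UNIV"
    and full: "full_resonance_rank \<Lambda> I" "full_resonance_rank \<Lambda>' I"
    using F F' by (auto simp: full_rank_support_def)
  have "CARD('l) \<le> CARD('k)"
  proof -
    \<comment> \<open>In both cases Krull dimension plus ambient dimension is n, so both Krull
      dimensions are finite, and comparing them bounds the ambient dimensions in the opposite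
      direction.\<close>
    have le: "krull_dim (resonance_algebra \<Lambda> I) \<le> krull_dim (resonance_algebra \<Lambda>' I)"
      using \<theta> by (intro krull_dim_le_if_surjective_hom cring_monoid_algebra submonoid_resonances)
        (auto simp: bij_betw_def)
    show ?thesis
      using full le unfolding full_resonance_rank_def
      by (cases "krull_dim (resonance_algebra \<Lambda> I)"; cases "krull_dim (resonance_algebra \<Lambda>' I)") auto
  qed
  then show ?thesis
    by (intro linearly_equivalent_if_kernel_subset span kernel)
qed

theorem theorem8p2:
  fixes \<Lambda> :: "'n::finite \<Rightarrow> complex ^ 'k::finite" and I :: "'n set"
  assumes "vec.span (range \<Lambda>) = UNIV"
    and "I \<noteq> {}" and "singular_support \<Lambda> I" and "full_resonance_rank \<Lambda> I"
  shows "(\<forall>\<Lambda>' :: 'n \<Rightarrow> complex ^ 'l::finite.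
            vec.span (range \<Lambda>') = UNIV \<and> singular_support \<Lambda>' I \<and> full_resonance_rank \<Lambda>' I \<and>
            same_labelled_data \<Lambda> \<Lambda>' I \<longrightarrow>
            linearly_equivalent (coord_space UNIV) \<Lambda> (coord_space UNIV) \<Lambda>')
    \<and> (\<exists>A. linear_extension \<Lambda> I A)
    \<and> (\<forall>A A'. linear_extension \<Lambda> I A \<and> linear_extension \<Lambda> I A' \<longrightarrow>
          linearly_equivalent (reconstructed_space \<Lambda> I) (reconstructed_weights \<Lambda> I A)
                              (reconstructed_space \<Lambda> I) (reconstructed_weights \<Lambda> I A'))
    \<and> (\<forall>A. linear_extension \<Lambda> I A \<longrightarrow>
          linearly_equivalent (reconstructed_space \<Lambda> I) (reconstructed_weights \<Lambda> I A)
                              (coord_space UNIV) \<Lambda>)"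
proof -
  interpret F: full_rank_support \<Lambda> I by unfold_locales (use assms in auto)
  have "linearly_equivalent (coord_space UNIV) \<Lambda> (coord_space UNIV) \<Lambda>'"
    if "vec.span (range \<Lambda>') = UNIV" "full_resonance_rank \<Lambda>' I" "same_labelled_data \<Lambda> \<Lambda>' I"
    for \<Lambda>' :: "'n \<Rightarrow> complex ^ 'l"
    using that
    by (intro linearly_equivalent_if_same_labelled_data[OF F.full_rank_support_axioms])
      (auto simp: full_rank_support_def)
  then show ?thesis
    using F.ex_linear_extension F.reconstructed_independent_of_extension
      F.reconstructed_equivalent_weights
    by blast
qed

end
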